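(* There exist universal constants $C_1,C_2>0$ such that the following holds. Let $m\ge n\ge 1$ with $m/n=\delta\ge 1$ fixed, $r\ge1$, $\alpha>0$, let $f:\mathbb{R}\to[0,1]$ be twice differentiable with $f(x)$ log-concave in $x$, and let $\gamma_\alpha$ and $L_\alpha$ be as in the context, with $\gamma_\alpha>0$. Suppose that $M^*\in\mathcal{C}$, that the bipartite graph $G$ associated with $\Omega\subseteq[m]\times[n]$ satisfies assumptions (A1) and (A2), and that $Y$ is generated from $M^*$ according to the 1-bit observation model. Let $p=\frac{|\Omega|}{mn}$ be fixed independent of $m$ and $n$. Then with probability at least $1-C_1\exp(-C_2 m)$, any global minimizer $\widehat{M}$ of $$\min_{M} F_{\Omega,Y}(M)\quad\text{subject to}\quad \|M\|_\infty\le\alpha,\ \operatorname{rank}(M)\le r$$ satisfies $$\frac{1}{\sqrt{mn}}\|\widehat{M}-M^*\|_F\le \mathcal{O}\left(\frac{\delta}{p^2}\sqrt{\frac{r^3}{n}}\right),$$ where the constant implied by $\mathcal{O}$ depends only on $\alpha$, $L_\alpha$, $\gamma_\alpha$ and the constant $C$ of (A2).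
   Context: Norms: for a real matrix $A$, $\|A\|_\infty=\max_{i,j}|A_{ij}|$ (entrywise) and $\|A\|_F$ is the Frobenius norm. $[n]=\{1,\dots,n\}$. Constraint set: $\mathcal{C}=\{M\in\mathbb{R}^{m\times n}: \|M\|_\infty\le\alpha,\ \operatorname{rank}(M)\le r\}$. 1-bit observation model: for a fixed matrix $M^*\in\mathbb{R}^{m\times n}$ and a fixed index set $\Omega\subseteq[m]\times[n]$, the random variables $Y_{ij}$, $(i,j)\in\Omega$, are independent, with $Y_{ij}=+1$ with probability $f(M^*_{ij})$ and $Y_{ij}=-1$ with probability $1-f(M^*_{ij})$. Negative log-likelihood ($\mathbb{I}$ denotes the indicator): $$F_{\Omega,Y}(M)=-\sum_{(i,j)\in\Omega}\Big\{\mathbb{I}_{(Y_{ij}=1)}\log f(M_{ij})+\mathbb{I}_{(Y_{ij}=-1)}\log(1-f(M_{ij}))\Big\}.$$ With $\dot f,\ddot f$ the first and second derivatives of $f$, $\gamma_\alpha$ and $L_\alpha$ are real numbers satisfying $$\gamma_\alpha\le\min\left(\inf_{|x|\le\alpha}\Big\{\frac{\dot f^2(x)}{f^2(x)}-\frac{\ddot f(x)}{f(x)}\Big\},\ \inf_{|x|\le\alpha}\Big\{\frac{\dot f^2(x)}{(1-f(x))^2}+\frac{\ddot f(x)}{1-f(x)}\Big\}\right),\qquad L_\alpha\ge\sup_{|x|\le\alpha}\frac{|\dot f(x)|}{f(x)(1-f(x))}$$ (it is implicit that $0<f(x)<1$ for $|x|\le\alpha$, so that these are well defined). Graph: $G$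 is the bipartite graph on $([m],[n])$ with edge set $\Omega$, identified with its $m\times n$ bi-adjacency matrix: $G_{ij}=1$ if $(i,j)\in\Omega$ and $G_{ij}=0$ otherwise. $\sigma_1(G)\ge\sigma_2(G)$ are its largest and second largest singular values. It is assumed that each row of $G$ has exactly $d$ nonzero entries, so $|\Omega|=md$. (A1) The top left and right singular vectors of $G$ are $\mathbf{1}_m/\sqrt m$ and $\mathbf{1}_n/\sqrt n$ ($\mathbf{1}_k$ is the all-ones vector in $\mathbb{R}^k$). This implies $\sigma_1(G)=d\sqrt{m/n}\ge d$ and that each column of $G$ has $md/n$ nonzero entries. (A2) $\sigma_2(G)\le C\sqrt d$, where $C>0$ is a universal constant. *)

theory Defs
  imports
    "HOL-Probability.Product_PMF"
    "HOL-Analysis.Derivative"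
    "Jordan_Normal_Form.Char_Poly"
    "Jordan_Normal_Form.DL_Rank"
begin

text \<open>
  Matrices in \<open>\<real>\<^sup>m\<^sup>\<times>\<^sup>n\<close> are elements of \<open>carrier_mat m n\<close>; row and column indices
  start at \<open>0\<close>, so \<open>[m] \<times> [n]\<close> becomes \<open>{..<m} \<times> {..<n}\<close>.
\<close>

section \<open>Norms, rank and singular values\<close>

text \<open>Only meaningful for matrices with at least one entry.\<close>

definition max_norm :: "real mat \<Rightarrow> real" where
  "max_norm A = Max (abs ` elements_mat A)"

definition frobenius_norm :: "real mat \<Rightarrow> real" where
  "frobenius_norm A = sqrt (\<Sum>i<dim_row A. \<Sum>j<dim_col A. (A $$ (i, j))\<^sup>2)"

abbreviation mat_rank :: "real mat \<Rightarrow> nat" where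
  "mat_rank A \<equiv> vec_space.rank (dim_row A) A"

text \<open>
  The square roots of the eigenvalues of \<open>A\<^sup>T A\<close>, with multiplicity and in decreasing order.
  The list has \<open>dim_col A\<close> entries; for a matrix with fewer rows than columns the usual list of
  \<open>min (dim_row A) (dim_col A)\<close> singular values is thus padded with zeros.
\<close>

definition singular_values :: "real mat \<Rightarrow> real list" where
  "singular_values A =
     rev (sorted_list_of_multiset (image_mset sqrt (proots (char_poly (transpose_mat A * A)))))"

text \<open>\<open>sing_val k A\<close> is \<open>\<sigma>\<^sub>k(A)\<close> for \<open>k \<ge> 1\<close>, and \<open>0\<close> beyond the last singular value.\<close>

definition sing_val :: "nat \<Rightarrow> real mat \<Rightarrow> real" where
  "sing_val k A =
     (if k - 1 < length (singular_values A) then singular_values A ! (k - 1) else 0)"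

definition top_singular_vectors :: "real mat \<Rightarrow> real vec \<Rightarrow> real vec \<Rightarrow> bool" where
  "top_singular_vectors A u v \<longleftrightarrow>
     u \<in> carrier_vec (dim_row A) \<and> v \<in> carrier_vec (dim_col A) \<and>
     scalar_prod u u = 1 \<and> scalar_prod v v = 1 \<and>
     A *\<^sub>v v = sing_val 1 A \<cdot>\<^sub>v u \<and>
     transpose_mat A *\<^sub>v u = sing_val 1 A \<cdot>\<^sub>v v"

definition ones_vec :: "nat \<Rightarrow> real vec" where
  "ones_vec k = Matrix.vec k (\<lambda>_. 1)"

definition constraint_set :: "nat \<Rightarrow> nat \<Rightarrow> real \<Rightarrow> nat \<Rightarrow> real mat set" where
  "constraint_set m n \<alpha> r = {M \<in> carrier_mat m n. max_norm M \<le> \<alpha> \<and> mat_rank M \<le> r}"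

section \<open>The bipartite graph\<close>

definition biadjacency :: "nat \<Rightarrow> nat \<Rightarrow> (nat \<times> nat) set \<Rightarrow> real mat" where
  "biadjacency m n \<Omega> = Matrix.mat m n (\<lambda>e. if e \<in> \<Omega> then 1 else 0)"

definition assumption_A1 :: "nat \<Rightarrow> nat \<Rightarrow> (nat \<times> nat) set \<Rightarrow> bool" where
  "assumption_A1 m n \<Omega> \<longleftrightarrow>
     top_singular_vectors (biadjacency m n \<Omega>)
       ((1 / sqrt (real m)) \<cdot>\<^sub>v ones_vec m) ((1 / sqrt (real n)) \<cdot>\<^sub>v ones_vec n)"

definition assumption_A2 :: "nat \<Rightarrow> nat \<Rightarrow> (nat \<times> nat) set \<Rightarrow> nat \<Rightarrow> real \<Rightarrow> bool" where
  "assumption_A2 m n \<Omega> d C \<longleftrightarrow> sing_val 2 (biadjacency m n \<Omega>) \<le> C * sqrt (real d)"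

section \<open>The 1-bit observation model\<close>

text \<open>
  The joint law of the independent signs \<open>Y\<^sub>i\<^sub>j\<close>, \<open>(i, j) \<in> \<Omega>\<close>. Outside \<open>\<Omega>\<close> a sample
  carries the dummy value \<open>0\<close>, which is never used.
\<close>

definition one_bit_model :: "(real \<Rightarrow> real) \<Rightarrow> real mat \<Rightarrow> (nat \<times> nat) set \<Rightarrow> (nat \<times> nat \<Rightarrow> int) pmf" where
  "one_bit_model f M \<Omega> =
     Pi_pmf \<Omega> 0 (\<lambda>e. map_pmf (\<lambda>b. if b then 1 else - 1) (bernoulli_pmf (f (M $$ e))))"

definition neg_log_lik ::
    "(real \<Rightarrow> real) \<Rightarrow> (nat \<times> nat) set \<Rightarrow> (nat \<times> nat \<Rightarrow> int) \<Rightarrow> real mat \<Rightarrow> real" where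
  "neg_log_lik f \<Omega> Y M =
     - (\<Sum>e\<in>\<Omega>. of_bool (Y e = 1) * ln (f (M $$ e)) + of_bool (Y e = - 1) * ln (1 - f (M $$ e)))"

section \<open>Hypotheses on the link function\<close>

definition twice_differentiable :: "(real \<Rightarrow> real) \<Rightarrow> bool" where
  "twice_differentiable f \<longleftrightarrow> (\<forall>x. f differentiable (at x)) \<and> (\<forall>x. deriv f differentiable (at x))"

text \<open>
  Where \<open>f\<close> vanishes, \<open>ln f\<close> is read as \<open>-\<infinity>\<close>: concavity of this extended-valued function
  says that \<open>{x. 0 < f x}\<close> is convex, which is part of \<open>concave_on\<close>, and that \<open>ln f\<close> is
  concave there.
\<close>

definition log_concave :: "(real \<Rightarrow> real) \<Rightarrow> bool" where
  "log_concave f \<longleftrightarrow> (\<forall>x. 0 \<le> f x) \<and> concave_on {x. 0 < f x} (\<lambda>x. ln (f x))"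

text \<open>
  Infimum and supremum are taken in the extended reals, where they are the true ones even
  for unbounded functions.
\<close>

definition gamma_bound :: "(real \<Rightarrow> real) \<Rightarrow> real \<Rightarrow> ereal" where
  "gamma_bound f \<alpha> = min
     (INF x\<in>{- \<alpha>..\<alpha>}. ereal ((deriv f x)\<^sup>2 / (f x)\<^sup>2 - deriv (deriv f) x / f x))
     (INF x\<in>{- \<alpha>..\<alpha>}. ereal ((deriv f x)\<^sup>2 / (1 - f x)\<^sup>2 + deriv (deriv f) x / (1 - f x)))"

definition L_bound :: "(real \<Rightarrow> real) \<Rightarrow> real \<Rightarrow> ereal" where
  "L_bound f \<alpha> = (SUP x\<in>{- \<alpha>..\<alpha>}. ereal (\<bar>deriv f x\<bar> / (f x * (1 - f x))))"

end

(*
  The entrywise negative log-likelihood is gamma-strongly convex on [-alpha, alpha], so a minimiser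
  M satisfies gamma/2 * sum_Omega D^2 <= |<Z, D>| for D = M - Mstar, where the score matrix Z has
  independent centred bounded entries. By duality |<Z, D>| <= |Z|_op sqrt(rank D) |D|_F, and a
  union bound over a lattice net gives |Z|_op = O(sqrt m) with probability 1 - exp(-m).
  Conversely, G - d/n * J (J the all-ones matrix) has operator norm at most sigma_2(G), so the same
  duality applied to the entrywise square of D, of rank at most (rank D)^2 and Frobenius norm at
  most 2 alpha |D|_F, shows that sum_Omega D^2 is at least p |D|_F^2 - O(r sqrt d |D|_F).
  Together, p |D|_F = O(r sqrt m), which is stronger than the stated rate.
*)
theory Submission
  imports Defs "HOL-Probability.Hoeffding"
begin

section \<open>Low-rank matrices and operator norm bounds\<close>

text \<open>The minimiser depends on \<open>Y\<close>, so no concentration bound for one fixed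
  \<open>D\<close> applies to <Z, D>; the operator norm controls this pairing for all low-rank
  \<open>D\<close> at once. No singular value decomposition enters: low rank means a sum of k
  products, and an orthogonal family from Gram-Schmidt takes over the role of the singular vectors
  in the duality. Matrices are plain functions of two indices, and an operator norm occurs only
  through the inequality \<open>op_bound\<close>.

  The laborious step is (A2). \<open>sing_val 2\<close> is read off the roots of a characteristic
  polynomial, counted with multiplicity, whereas the argument needs |G y| <= sigma_2 |y| for every y
  whose entries sum to 0. The bridge is a maximiser of |G y| over unit vectors of that kind: it is
  an eigenvector of G^T G, and its eigenvalue is shown to be a root besides that of the all-ones
  vector, even when the two coincide.

  The stated rate follows from p |D|_F = O(r sqrt m) by r <= sqrt (r^3) and p <= 1 <= delta.\<close>

definition op_bound :: "nat \<Rightarrow> nat \<Rightarrow> (nat \<Rightarrow> nat \<Rightarrow> real) \<Rightarrow> real \<Rightarrow> bool" where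
  "op_bound m n A s \<longleftrightarrow>
     (\<forall>y. L2_set (\<lambda>i. \<Sum>j<n. A i j * y j) {..<m} \<le> s * L2_set y {..<n})"

text \<open>Rank as a number of rank-one terms makes differences and entrywise squares direct
  computations. Terms may vanish, so \<open>k\<close> is only an upper bound.\<close>

definition rank_le :: "nat \<Rightarrow> nat \<Rightarrow> nat \<Rightarrow> (nat \<Rightarrow> nat \<Rightarrow> real) \<Rightarrow> bool" where
  "rank_le m n k A \<longleftrightarrow> (\<exists>a b. \<forall>i<m. \<forall>j<n. A i j = (\<Sum>l<k. a l i * b l j))"

definition frob :: "nat \<Rightarrow> nat \<Rightarrow> (nat \<Rightarrow> nat \<Rightarrow> real) \<Rightarrow> real" where
  "frob m n A = sqrt (\<Sum>i<m. \<Sum>j<n. (A i j)\<^sup>2)"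

lemma frob_nonneg: "0 \<le> frob m n A"
  by (simp add: frob_def sum_nonneg)

lemma abs_sum_mult_le_L2_set:
  "\<bar>\<Sum>i\<in>I. f i * g i\<bar> \<le> L2_set f I * L2_set g I"
proof -
  have "\<bar>\<Sum>i\<in>I. f i * g i\<bar> \<le> (\<Sum>i\<in>I. \<bar>f i\<bar> * \<bar>g i\<bar>)"
    using sum_abs[of "\<lambda>i. f i * g i" I] by (simp add: abs_mult)
  also have "\<dots> \<le> L2_set f I * L2_set g I"
    by (rule L2_set_mult_ineq)
  finally show ?thesis .
qed

text \<open>Gram-Schmidt in which a dependent vector contributes the zero vector instead of being
  dropped. The family keeps exactly \<open>k\<close> members, so no dimension has to be
  counted.\<close>

lemma ex_orthonormal_or_zero:
  fixes a :: "nat \<Rightarrow> 'a \<Rightarrow> real"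
  assumes "finite I"
  shows "\<exists>q c. (\<forall>s<k. \<forall>t<k. s \<noteq> t \<longrightarrow> (\<Sum>i\<in>I. q s i * q t i) = 0) \<and>
    (\<forall>s<k. (\<Sum>i\<in>I. q s i * q s i) \<in> {0, 1}) \<and>
    (\<forall>l<k. \<forall>i\<in>I. a l i = (\<Sum>s<k. c l s * q s i))"
proof (induction k)
  case 0
  show ?case by simp
next
  case (Suc k)
  then obtain q c where "\<forall>s<k. \<forall>t<k. s \<noteq> t \<longrightarrow> (\<Sum>i\<in>I. q s i * q t i) = 0"
    and "\<forall>s<k. (\<Sum>i\<in>I. q s i * q s i) \<in> {0, 1}"
    and "\<forall>l<k. \<forall>i\<in>I. a l i = (\<Sum>s<k. c l s * q s i)"
    by (elim exE conjE) (rule that)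
  note orth = this(1)[rule_format] and nrm = this(2)[rule_format] and rep = this(3)[rule_format]
  define e where "e s = (\<Sum>i\<in>I. a k i * q s i)" for s
  define v where "v i = a k i - (\<Sum>s<k. e s * q s i)" for i
  \<comment> \<open>If \<open>q t\<close> is the zero vector, then \<open>e t\<close> is 0 as well,
    so the identity covers both possible norms.\<close>
  have zero_e: "e t * (\<Sum>i\<in>I. q t i * q t i) = e t" if "t < k" for t
  proof (cases "(\<Sum>i\<in>I. q t i * q t i) = 0")
    case True
    then have "q t i = 0" if "i \<in> I" for i
      using that assms by (subst (asm) sum_nonneg_eq_0_iff) auto
    then show ?thesis by (simp add: e_def)
  next
    case False
    then show ?thesis using nrm[OF that] by auto
  qed
  have v_orth: "(\<Sum>i\<in>I. v i * q t i) = 0" if "t < k" for t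
  proof -
    have "(\<Sum>i\<in>I. v i * q t i) = e t - (\<Sum>i\<in>I. \<Sum>s<k. e s * q s i * q t i)"
      by (simp add: v_def e_def left_diff_distrib sum_subtractf sum_distrib_right)
    also have "(\<Sum>i\<in>I. \<Sum>s<k. e s * q s i * q t i) = (\<Sum>s<k. e s * (\<Sum>i\<in>I. q s i * q t i))"
      by (subst sum.swap) (simp add: sum_distrib_left mult.assoc)
    also have "\<dots> = (\<Sum>s<k. if s = t then e t * (\<Sum>i\<in>I. q t i * q t i) else 0)"
      by (intro sum.cong) (use orth that in auto)
    also have "\<dots> = e t" using zero_e[OF that] that by simp
    finally show ?thesis by simp
  qed
  define N where "N = sqrt (\<Sum>i\<in>I. v i * v i)"
  have N2: "N * N = (\<Sum>i\<in>I. v i * v i)"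
    by (simp add: N_def sum_nonneg)
  have N_zero: "v i = 0" if "N = 0" "i \<in> I" for i
    using that assms N2 by (simp add: sum_nonneg_eq_0_iff)
  \<comment> \<open>For \<open>N = 0\<close> division by zero makes the new vector 0; since
    \<open>v\<close> then vanishes on \<open>I\<close>, v = N (v / N) remains true.\<close>
  define q' where "q' s = (if s = k then (\<lambda>i. v i / N) else q s)" for s
  define c' where "c' l s = (if l = k then (if s = k then N else e s)
    else if s = k then 0 else c l s)" for l s
  have "(\<Sum>i\<in>I. q' s i * q' t i) = 0" if "s < Suc k" "t < Suc k" "s \<noteq> t" for s t
  proof -
    consider "s = k" "t < k" | "t = k" "s < k" | "s < k" "t < k" using \<open>s < Suc k\<close> \<open>t < Suc k\<close> \<open>s \<noteq> t\<close> by linarith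
    then show ?thesis
    proof cases
      case 1
      then show ?thesis using v_orth[of t]
        by (simp add: q'_def flip: sum_divide_distrib)
    next
      case 2
      then show ?thesis using v_orth[of s]
        by (simp add: q'_def mult.commute flip: sum_divide_distrib)
    next
      case 3
      then show ?thesis using orth that by (simp add: q'_def)
    qed
  qed
  moreover have "(\<Sum>i\<in>I. q' s i * q' s i) \<in> {0, 1}" if "s < Suc k" for s
  proof (cases "s = k")
    case True
    then have "(\<Sum>i\<in>I. q' s i * q' s i) = N * N / (N * N)"
      by (simp add: q'_def N2 flip: sum_divide_distrib)
    then show ?thesis by (cases "N = 0") auto
  next
    case False
    then show ?thesis using nrm[of s] that by (simp add: q'_def)
  qed
  moreover have "a l i = (\<Sum>s<Suc k. c' l s * q' s i)" if "l < Suc k" "i \<in> I" for l i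
  proof (cases "l = k")
    case True
    have "a k i = (\<Sum>s<k. e s * q s i) + v i" by (simp add: v_def)
    moreover have "v i = N * (v i / N)" using N_zero[OF _ that(2)] by (cases "N = 0") auto
    ultimately show ?thesis using True by (simp add: c'_def q'_def)
  next
    case False
    then show ?thesis using rep[of l i] that by (simp add: c'_def q'_def)
  qed
  ultimately show ?case
    by (intro exI[of _ q'] exI[of _ c'] conjI allI impI ballI)
qed

text \<open>In A = sum of q_s w_s^T the projection q_s^T A equals |q_s|^2 w_s, and |q_s|^2 q_s = q_s
  whether the norm is 0 or 1. So w_s may be replaced by the explicit coefficient q_s^T A, which
  Parseval's identity requires.\<close>

lemma rank_le_orthonormal_expansion:
  assumes "rank_le m n k A"
  obtains q :: "nat \<Rightarrow> nat \<Rightarrow> real" where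
    "\<And>s. s < k \<Longrightarrow> L2_set (q s) {..<m} \<le> 1"
    "\<And>i j. i < m \<Longrightarrow> j < n \<Longrightarrow> A i j = (\<Sum>s<k. q s i * (\<Sum>i'<m. q s i' * A i' j))"
proof -
  obtain a b where A: "\<And>i j. i < m \<Longrightarrow> j < n \<Longrightarrow> A i j = (\<Sum>l<k. a l i * b l j)"
    using assms unfolding rank_le_def by blast
  obtain q c where "\<forall>s<k. \<forall>t<k. s \<noteq> t \<longrightarrow> (\<Sum>i<m. q s i * q t i) = 0"
    and "\<forall>s<k. (\<Sum>i<m. q s i * q s i) \<in> {0, 1}"
    and "\<forall>l<k. \<forall>i\<in>{..<m}. a l i = (\<Sum>s<k. c l s * q s i)"
    using ex_orthonormal_or_zero[OF finite_lessThan, of k m a] by (elim exE conjE) (rule that)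
  note orth = this(1)[rule_format] and nrm = this(2)[rule_format] and
    rep = this(3)[rule_format, unfolded lessThan_iff]
  define w where "w s j = (\<Sum>l<k. c l s * b l j)" for s j
  have Aw: "A i j = (\<Sum>s<k. q s i * w s j)" if "i < m" "j < n" for i j
  proof -
    have "A i j = (\<Sum>l<k. \<Sum>s<k. c l s * q s i * b l j)"
      using that by (simp add: A rep sum_distrib_right)
    also have "\<dots> = (\<Sum>s<k. q s i * w s j)"
      by (subst sum.swap) (simp add: w_def sum_distrib_left mult_ac)
    finally show ?thesis .
  qed
  have proj: "(\<Sum>i<m. q s i * A i j) = (\<Sum>i<m. q s i * q s i) * w s j" if "s < k" "j < n" for s j
  proof -
    have "(\<Sum>i<m. q s i * A i j) = (\<Sum>i<m. \<Sum>t<k. q s i * q t i * w t j)"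
      using that by (simp add: Aw sum_distrib_left mult_ac)
    also have "\<dots> = (\<Sum>t<k. (\<Sum>i<m. q s i * q t i) * w t j)"
      by (subst sum.swap) (simp add: sum_distrib_right)
    also have "\<dots> = (\<Sum>t<k. if t = s then (\<Sum>i<m. q s i * q s i) * w s j else 0)"
      by (intro sum.cong) (use orth that in auto)
    also have "\<dots> = (\<Sum>i<m. q s i * q s i) * w s j" using that by simp
    finally show ?thesis .
  qed
  have fix_q: "q s i * (\<Sum>i<m. q s i * q s i) = q s i" if "s < k" "i < m" for s i
  proof (cases "(\<Sum>i<m. q s i * q s i) = 0")
    case True
    then have "q s i = 0" using that by (simp add: sum_nonneg_eq_0_iff)
    then show ?thesis by simp
  next
    case False
    then show ?thesis using nrm[OF that(1)] by auto
  qed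
  show thesis
  proof
    fix s assume "s < k"
    then show "L2_set (q s) {..<m} \<le> 1"
      using nrm[of s] by (auto simp: L2_set_def power2_eq_square)
  next
    fix i j assume ij: "i < m" "j < n"
    show "A i j = (\<Sum>s<k. q s i * (\<Sum>i'<m. q s i' * A i' j))"
      unfolding Aw[OF ij]
    proof (intro sum.cong refl)
      fix s assume "s \<in> {..<k}"
      then show "q s i * w s j = q s i * (\<Sum>i'<m. q s i' * A i' j)"
        using ij proj[of s j] fix_q[of s i] by (simp only: lessThan_iff) (metis mult.assoc)
    qed
  qed
qed

text \<open>Trace duality, with the nuclear norm replaced by a sum over the orthogonal family: for
  w_s = D^T q_s the pairing is the sum of the numbers q_s^T Z w_s, each at most S |w_s|, and
  Cauchy-Schwarz over s costs sqrt k.\<close>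

lemma abs_inner_le_op_bound_frob:
  assumes Z: "op_bound m n Z S" and "S \<ge> 0" and D: "rank_le m n k D"
  shows "\<bar>\<Sum>i<m. \<Sum>j<n. Z i j * D i j\<bar> \<le> S * sqrt (real k) * frob m n D"
proof -
  obtain q where q: "\<And>s. s < k \<Longrightarrow> L2_set (q s) {..<m} \<le> 1"
    and exp: "\<And>i j. i < m \<Longrightarrow> j < n \<Longrightarrow> D i j = (\<Sum>s<k. q s i * (\<Sum>i'<m. q s i' * D i' j))"
    by (rule rank_le_orthonormal_expansion[OF D], rule that)
  define w where "w s j = (\<Sum>i<m. q s i * D i j)" for s j
  have Dw: "D i j = (\<Sum>s<k. q s i * w s j)" if "i < m" "j < n" for i j
    using exp[OF that] by (simp add: w_def)
  \<comment> \<open>Parseval: only one of the two factors \<open>D i j\<close> is expanded, so that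
    summing the other against \<open>q s\<close> gives \<open>w s j\<close> again.\<close>
  have "(\<Sum>i<m. \<Sum>j<n. (D i j)\<^sup>2) = (\<Sum>i<m. \<Sum>j<n. \<Sum>s<k. D i j * (q s i * w s j))"
    unfolding power2_eq_square sum_distrib_left[symmetric]
    by (intro sum.cong refl arg_cong2[where f = "(*)"] Dw) auto
  also have "\<dots> = (\<Sum>i<m. \<Sum>s<k. \<Sum>j<n. D i j * (q s i * w s j))"
    by (rule sum.cong[OF refl], rule sum.swap)
  also have "\<dots> = (\<Sum>s<k. \<Sum>i<m. \<Sum>j<n. D i j * (q s i * w s j))"
    by (rule sum.swap)
  also have "\<dots> = (\<Sum>s<k. \<Sum>j<n. \<Sum>i<m. D i j * (q s i * w s j))"
    by (rule sum.cong[OF refl], rule sum.swap)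
  also have "\<dots> = (\<Sum>s<k. \<Sum>j<n. (w s j)\<^sup>2)"
    by (intro sum.cong refl)
       (simp add: w_def power2_eq_square sum_distrib_left sum_distrib_right mult_ac)
  also have "\<dots> = (\<Sum>s<k. (L2_set (w s) {..<n})\<^sup>2)"
    by (simp add: L2_set_def sum_nonneg)
  finally have frobw: "frob m n D = L2_set (\<lambda>s. L2_set (w s) {..<n}) {..<k}"
    by (simp add: frob_def L2_set_def)
  have "(\<Sum>i<m. \<Sum>j<n. Z i j * D i j) = (\<Sum>i<m. \<Sum>j<n. \<Sum>s<k. Z i j * (q s i * w s j))"
    unfolding sum_distrib_left[symmetric]
    by (intro sum.cong refl arg_cong2[where f = "(*)"] Dw) auto
  also have "\<dots> = (\<Sum>i<m. \<Sum>s<k. \<Sum>j<n. Z i j * (q s i * w s j))"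
    by (rule sum.cong[OF refl], rule sum.swap)
  also have "\<dots> = (\<Sum>s<k. \<Sum>i<m. \<Sum>j<n. Z i j * (q s i * w s j))"
    by (rule sum.swap)
  also have "\<dots> = (\<Sum>s<k. \<Sum>i<m. q s i * (\<Sum>j<n. Z i j * w s j))"
    by (simp add: sum_distrib_left mult_ac)
  also have "\<bar>\<dots>\<bar> \<le> (\<Sum>s<k. \<bar>\<Sum>i<m. q s i * (\<Sum>j<n. Z i j * w s j)\<bar>)"
    by (rule sum_abs)
  also have "\<dots> \<le> (\<Sum>s<k. \<bar>1\<bar> * \<bar>S * L2_set (w s) {..<n}\<bar>)"
  proof (intro sum_mono)
    fix s assume "s \<in> {..<k}"
    have "\<bar>\<Sum>i<m. q s i * (\<Sum>j<n. Z i j * w s j)\<bar>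
      \<le> L2_set (q s) {..<m} * L2_set (\<lambda>i. \<Sum>j<n. Z i j * w s j) {..<m}"
      by (rule abs_sum_mult_le_L2_set)
    also have "\<dots> \<le> 1 * (S * L2_set (w s) {..<n})"
      using q \<open>s \<in> _\<close> Z unfolding op_bound_def by (intro mult_mono) (auto simp: L2_set_nonneg)
    finally show "\<bar>\<Sum>i<m. q s i * (\<Sum>j<n. Z i j * w s j)\<bar> \<le> \<bar>1\<bar> * \<bar>S * L2_set (w s) {..<n}\<bar>"
      by simp
  qed
  also have "\<dots> \<le> L2_set (\<lambda>s. 1) {..<k} * L2_set (\<lambda>s. S * L2_set (w s) {..<n}) {..<k}"
    by (rule L2_set_mult_ineq)
  also have "\<dots> = S * sqrt (real k) * frob m n D"
    unfolding frobw using \<open>S \<ge> 0\<close>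
    by (simp add: L2_set_def power_mult_distrib real_sqrt_mult flip: sum_distrib_left)
  finally show ?thesis .
qed

lemma rank_le_diff:
  assumes "rank_le m n k A" "rank_le m n k' B"
  shows "rank_le m n (k + k') (\<lambda>i j. A i j - B i j)"
proof -
  obtain a b where A: "\<And>i j. i < m \<Longrightarrow> j < n \<Longrightarrow> A i j = (\<Sum>l<k. a l i * b l j)"
    using assms unfolding rank_le_def by blast
  obtain a' b' where B: "\<And>i j. i < m \<Longrightarrow> j < n \<Longrightarrow> B i j = (\<Sum>l<k'. a' l i * b' l j)"
    using assms unfolding rank_le_def by blast
  define a2 where "a2 l = (if l < k then a l else (\<lambda>i. - a' (l - k) i))" for l
  define b2 where "b2 l = (if l < k then b l else b' (l - k))" for l
  have split: "{..<k + k'} = {..<k} \<union> (+) k ` {..<k'}"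
  proof (intro Set.set_eqI iffI)
    fix x assume x: "x \<in> {..<k + k'}"
    show "x \<in> {..<k} \<union> (+) k ` {..<k'}"
    proof (cases "x < k")
      case False
      then have "x = k + (x - k)" "x - k \<in> {..<k'}" using x by auto
      then show ?thesis by blast
    qed simp
  qed auto
  have "(\<Sum>l<k + k'. a2 l i * b2 l j) = (\<Sum>l<k. a l i * b l j) + (\<Sum>l<k'. - (a' l i * b' l j))" for i j
    unfolding split by (subst sum.union_disjoint) (auto simp: sum.reindex a2_def b2_def)
  then show ?thesis
    unfolding rank_le_def by (intro exI[of _ a2] exI[of _ b2]) (simp add: A B sum_negf)
qed

text \<open>Squaring a sum of k products gives one product for each pair (u, v) of indices; the pair
  is encoded as the single index \<open>u * k + v\<close>.\<close>

lemma rank_le_square: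
  assumes "rank_le m n k A"
  shows "rank_le m n (k * k) (\<lambda>i j. (A i j)\<^sup>2)"
proof -
  obtain a b where A: "\<And>i j. i < m \<Longrightarrow> j < n \<Longrightarrow> A i j = (\<Sum>l<k. a l i * b l j)"
    using assms unfolding rank_le_def by blast
  have index_less: "u * k + v < k * k" if "u < k" "v < k" for u v
  proof -
    have "u * k + v < (u + 1) * k" using that by simp
    also have "\<dots> \<le> k * k" using that by (intro mult_le_mono1) simp
    finally show ?thesis .
  qed
  have "(A i j)\<^sup>2 = (\<Sum>l<k * k. (a (l div k) i * a (l mod k) i) * (b (l div k) j * b (l mod k) j))"
    if "i < m" "j < n" for i j
  proof -
    have "(A i j)\<^sup>2 = (\<Sum>u<k. \<Sum>v<k. (a u i * a v i) * (b u j * b v j))"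
      using that by (simp add: A power2_eq_square sum_product mult_ac)
    also have "\<dots> = (\<Sum>(u, v)\<in>{..<k} \<times> {..<k}. (a u i * a v i) * (b u j * b v j))"
      by (simp add: sum.cartesian_product)
    also have "\<dots> = (\<Sum>l<k * k. (a (l div k) i * a (l mod k) i) * (b (l div k) j * b (l mod k) j))"
      by (rule sum.reindex_bij_witness[of _ "\<lambda>l. (l div k, l mod k)" "\<lambda>(u, v). u * k + v"])
         (auto simp: less_mult_imp_div_less index_less intro!: mod_less_divisor Nat.gr0I)
    finally show ?thesis .
  qed
  then show ?thesis unfolding rank_le_def
    by (intro exI[of _ "\<lambda>l i. a (l div k) i * a (l mod k) i"]
              exI[of _ "\<lambda>l j. b (l div k) j * b (l mod k) j"]) simp
qed

section \<open>The second singular value\<close>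

text \<open>The first-order condition at an extremum, without derivatives. At the test point t = - B
  / (q + 1) the expression equals - t^2 (q + 2).\<close>

lemma linear_coeff_zero_if_quadratic_nonneg:
  fixes B q :: real
  assumes "\<And>t. 0 \<le> 2 * t * B + t\<^sup>2 * q" and "0 \<le> q"
  shows "B = 0"
proof -
  define t where "t = - B / (q + 1)"
  have tB: "B = - t * (q + 1)" using \<open>0 \<le> q\<close> by (simp add: t_def)
  have "2 * t * B + t\<^sup>2 * q = - (t\<^sup>2 * (q + 2))"
    unfolding tB by (simp add: power2_eq_square algebra_simps)
  then have "t\<^sup>2 * (q + 2) \<le> 0" using assms(1)[of t] by simp
  then have "t = 0" using \<open>0 \<le> q\<close> by (simp add: mult_le_0_iff)
  then show ?thesis using tB by simp
qed

text \<open>Vectors are functions on all of \<open>nat\<close>, an infinite-dimensional space;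
  pinning the coordinates from \<open>n\<close> on to 0 restores compactness, by Tychonoff's
  theorem.\<close>

lemma compact_coordinate_box: "compact {w :: nat \<Rightarrow> real. \<forall>i. w i \<in> (if i < n then {-1..1} else {0})}"
proof -
  have "compactin (product_topology (\<lambda>i. euclidean) UNIV)
      (PiE UNIV (\<lambda>i. if i < n then {-1..1::real} else {0}))"
    unfolding compactin_PiE by (auto simp: compactin_euclidean_iff)
  then have "compact (PiE UNIV (\<lambda>i. if i < n then {-1..1::real} else {0}))"
    by (simp add: euclidean_product_topology compactin_euclidean_iff)
  moreover have "PiE UNIV (\<lambda>i. if i < n then {-1..1::real} else {0}) =
      {w. \<forall>i. w i \<in> (if i < n then {-1..1} else {0})}"
    by (simp add: PiE_UNIV_domain FuncSet.Pi_def)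
  ultimately show ?thesis by simp
qed

text \<open>The maximum of |A y|^2 over the unit sphere of the complement of \<open>v\<close> exists
  by compactness and extends to all y by homogeneity. The vector \<open>z\<close> witnesses that
  this sphere is not empty.\<close>

lemma ex_max_quadratic_form_orthogonal:
  fixes A :: "nat \<Rightarrow> nat \<Rightarrow> real" and v :: "nat \<Rightarrow> real"
  assumes z: "(\<Sum>j<n. z j * v j) = 0" "(\<Sum>j<n. (z j)\<^sup>2) \<noteq> 0"
  obtains w l where "(\<Sum>j<n. (w j)\<^sup>2) = 1" "(\<Sum>j<n. w j * v j) = 0"
    "(\<Sum>i<m. (\<Sum>j<n. A i j * w j)\<^sup>2) = l"
    "\<And>y. (\<Sum>j<n. y j * v j) = 0 \<Longrightarrow>
      (\<Sum>i<m. (\<Sum>j<n. A i j * y j)\<^sup>2) \<le> l * (\<Sum>j<n. (y j)\<^sup>2)"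
proof -
  define Q where "Q y = (\<Sum>i<m. (\<Sum>j<n. A i j * y j)\<^sup>2)" for y :: "nat \<Rightarrow> real"
  define K where "K = {w :: nat \<Rightarrow> real. \<forall>i. w i \<in> (if i < n then {-1..1} else {0})} \<inter>
    ({w. (\<Sum>j<n. (w j)\<^sup>2) = 1} \<inter> {w. (\<Sum>j<n. w j * v j) = 0})"
  define nz where "nz y = (\<lambda>j. if j < n then y j / sqrt (\<Sum>j<n. (y j)\<^sup>2) else 0)" for y :: "nat \<Rightarrow> real"
  have nz_K: "nz y \<in> K" if y: "(\<Sum>j<n. y j * v j) = 0" "(\<Sum>j<n. (y j)\<^sup>2) \<noteq> 0" for y
  proof -
    have pos: "(\<Sum>j<n. (y j)\<^sup>2) > 0" using y(2) by (simp add: sum_nonneg order_less_le)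
    have one: "(\<Sum>j<n. (nz y j)\<^sup>2) = 1"
      using pos by (simp add: nz_def power_divide flip: sum_divide_distrib)
    have orth: "(\<Sum>j<n. nz y j * v j) = 0"
      using y(1) by (simp add: nz_def flip: sum_divide_distrib)
    have "nz y i \<in> (if i < n then {-1..1} else {0})" for i
    proof (cases "i < n")
      case True
      then have "(nz y i)\<^sup>2 \<le> (\<Sum>j<n. (nz y j)\<^sup>2)"
        by (intro member_le_sum) auto
      then have "\<bar>nz y i\<bar> \<le> 1" using one by (simp add: abs_square_le_1)
      then show ?thesis using True by auto
    qed (simp add: nz_def)
    then show ?thesis using one orth by (simp add: K_def)
  qed
  have coord: "continuous_on S (\<lambda>w :: nat \<Rightarrow> real. w i)" for S i
    by (rule continuous_on_subset[OF continuous_on_product_coordinates]) simp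
  have comp: "compact K"
    unfolding K_def
    by (intro compact_Int_closed compact_coordinate_box closed_Int closed_Collect_eq
      continuous_intros coord)
  have "K \<noteq> {}" using nz_K[OF z] by blast
  moreover have "continuous_on K Q"
    unfolding Q_def by (intro continuous_intros coord)
  ultimately have "\<exists>w\<in>K. \<forall>y\<in>K. Q y \<le> Q w"
    by (rule continuous_attains_sup[OF comp])
  then obtain w where w: "w \<in> K" and max: "\<And>y. y \<in> K \<Longrightarrow> Q y \<le> Q w"
    by (elim bexE) (rule that, assumption, erule bspec)
  show thesis
  proof
    show "(\<Sum>j<n. (w j)\<^sup>2) = 1" "(\<Sum>j<n. w j * v j) = 0" using w by (auto simp: K_def)
    show "(\<Sum>i<m. (\<Sum>j<n. A i j * w j)\<^sup>2) = Q w" by (simp add: Q_def)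
    fix y :: "nat \<Rightarrow> real" assume y: "(\<Sum>j<n. y j * v j) = 0"
    define N where "N = (\<Sum>j<n. (y j)\<^sup>2)"
    show "(\<Sum>i<m. (\<Sum>j<n. A i j * y j)\<^sup>2) \<le> Q w * (\<Sum>j<n. (y j)\<^sup>2)"
    proof (cases "N = 0")
      case True
      then have "y j = 0" if "j < n" for j
        using that by (simp add: N_def sum_nonneg_eq_0_iff)
      then show ?thesis by simp
    next
      case False
      then have N: "N > 0" by (simp add: N_def sum_nonneg order_less_le)
      have "(\<Sum>j<n. A i j * nz y j) = (\<Sum>j<n. A i j * y j) / sqrt N" for i
        by (simp add: nz_def N_def sum_divide_distrib)
      then have "Q (nz y) = Q y / N"
        using N by (simp add: Q_def power_divide flip: sum_divide_distrib)
      moreover have "Q (nz y) \<le> Q w"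
        using False by (intro max nz_K y) (simp add: N_def)
      ultimately have "Q y \<le> Q w * N" using N by (simp add: pos_divide_le_eq)
      then show ?thesis by (simp add: Q_def N_def)
    qed
  qed
qed

text \<open>The residual e = l w - A^T A w is, up to a factor, the gradient of the constrained
  problem, so it is orthogonal to every h orthogonal to v. Since v is an eigenvector of A^T A, e is
  itself orthogonal to v; taking h = e gives e = 0.\<close>

lemma maximizer_orthogonal_eigenvector:
  fixes A :: "nat \<Rightarrow> nat \<Rightarrow> real" and v w :: "nat \<Rightarrow> real"
  assumes w: "(\<Sum>j<n. (w j)\<^sup>2) = 1" "(\<Sum>j<n. w j * v j) = 0"
    and l: "(\<Sum>i<m. (\<Sum>j<n. A i j * w j)\<^sup>2) = l"
    and max: "\<And>y. (\<Sum>j<n. y j * v j) = 0 \<Longrightarrow>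
      (\<Sum>i<m. (\<Sum>j<n. A i j * y j)\<^sup>2) \<le> l * (\<Sum>j<n. (y j)\<^sup>2)"
    and ev: "\<And>j. j < n \<Longrightarrow> (\<Sum>i<m. A i j * (\<Sum>j'<n. A i j' * v j')) = \<mu> * v j"
    and "j < n"
  shows "(\<Sum>i<m. A i j * (\<Sum>j'<n. A i j' * w j')) = l * w j"
proof -
  define T where "T y i = (\<Sum>j<n. A i j * y j)" for y i
  define e where "e j = l * w j - (\<Sum>i<m. A i j * T w i)" for j
  have inner_e: "(\<Sum>j<n. e j * h j) = l * (\<Sum>j<n. w j * h j) - (\<Sum>i<m. T w i * T h i)" for h
  proof -
    have "(\<Sum>j<n. (\<Sum>i<m. A i j * T w i) * h j) = (\<Sum>j<n. \<Sum>i<m. T w i * (A i j * h j))"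
      unfolding sum_distrib_right by (simp add: mult_ac)
    also have "\<dots> = (\<Sum>i<m. T w i * T h i)"
      by (subst sum.swap) (simp add: T_def sum_distrib_left)
    finally show ?thesis
      by (simp add: e_def left_diff_distrib sum_subtractf sum_distrib_left mult.assoc)
  qed
  have orth_e: "(\<Sum>j<n. e j * h j) = 0" if h: "(\<Sum>j<n. h j * v j) = 0" for h
  proof (rule linear_coeff_zero_if_quadratic_nonneg)
    show "0 \<le> l * (\<Sum>j<n. (h j)\<^sup>2) - (\<Sum>i<m. (T h i)\<^sup>2)"
      using max[OF h] by (simp add: T_def)
    fix t :: real
    have "(\<Sum>j<n. (w j + t * h j) * v j) = 0"
      using w(2) h by (simp add: distrib_right sum.distrib mult.assoc flip: sum_distrib_left)
    from max[OF this] have "(\<Sum>i<m. (T (\<lambda>j. w j + t * h j) i)\<^sup>2) \<le> l * (\<Sum>j<n. (w j + t * h j)\<^sup>2)"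
      by (simp add: T_def)
    moreover have "T (\<lambda>j. w j + t * h j) i = T w i + t * T h i" for i
      by (simp add: T_def distrib_left sum.distrib sum_distrib_left mult_ac)
    moreover have expand: "(\<Sum>k<N. (x k + t * z k)\<^sup>2) =
        (\<Sum>k<N. (x k)\<^sup>2) + 2 * t * (\<Sum>k<N. x k * z k) + t\<^sup>2 * (\<Sum>k<N. (z k)\<^sup>2)"
      for N :: nat and x z :: "nat \<Rightarrow> real"
      by (simp add: power2_sum power_mult_distrib sum.distrib sum_distrib_left mult_ac)
    ultimately have "(\<Sum>i<m. (T w i)\<^sup>2) + 2 * t * (\<Sum>i<m. T w i * T h i) + t\<^sup>2 * (\<Sum>i<m. (T h i)\<^sup>2)
      \<le> l * (1 + 2 * t * (\<Sum>j<n. w j * h j) + t\<^sup>2 * (\<Sum>j<n. (h j)\<^sup>2))"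
      using w(1) by simp
    moreover have "(\<Sum>i<m. (T w i)\<^sup>2) = l" using l by (simp add: T_def)
    ultimately show "0 \<le> 2 * t * (\<Sum>j<n. e j * h j) +
        t\<^sup>2 * (l * (\<Sum>j<n. (h j)\<^sup>2) - (\<Sum>i<m. (T h i)\<^sup>2))"
      unfolding inner_e by (simp add: algebra_simps)
  qed
  have "(\<Sum>i<m. T w i * T v i) = (\<Sum>i<m. \<Sum>j<n. w j * (A i j * T v i))"
    unfolding T_def[of w] sum_distrib_right by (simp add: mult_ac)
  also have "\<dots> = (\<Sum>j<n. w j * (\<Sum>i<m. A i j * T v i))"
    by (subst sum.swap) (simp add: sum_distrib_left)
  also have "\<dots> = (\<Sum>j<n. \<mu> * (w j * v j))"
    by (intro sum.cong) (simp_all add: T_def ev)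
  also have "\<dots> = 0" using w(2) by (simp flip: sum_distrib_left)
  finally have "(\<Sum>j<n. e j * v j) = 0" unfolding inner_e using w(2) by simp
  then have "(\<Sum>j<n. e j * e j) = 0" by (rule orth_e)
  then have "e j = 0" using \<open>j < n\<close> by (simp add: sum_nonneg_eq_0_iff)
  then show ?thesis by (simp add: e_def T_def)
qed

text \<open>Sylvester's determinant identity: both sides are the determinant of the block matrix
  \<open>?M\<close>, factored through one or the other of its Schur complements. With k = 1 it
  reduces a rank-one update to a scalar.\<close>

lemma det_one_plus_mult_commute:
  fixes V :: "'a :: idom mat"
  assumes V: "V \<in> carrier_mat n k" and R: "R \<in> carrier_mat k n"
  shows "det (1\<^sub>m n + V * R) = det (1\<^sub>m k + R * V)"
proof -
  let ?M = "four_block_mat (1\<^sub>m k) (- R) V (1\<^sub>m n)"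
  let ?L1 = "four_block_mat (1\<^sub>m k) (0\<^sub>m k n) V (1\<^sub>m n)"
  let ?U1 = "four_block_mat (1\<^sub>m k) (- R) (0\<^sub>m n k) (1\<^sub>m n + V * R)"
  let ?U2 = "four_block_mat (1\<^sub>m k) (- R) (0\<^sub>m n k) (1\<^sub>m n)"
  let ?L2 = "four_block_mat (1\<^sub>m k + R * V) (0\<^sub>m k n) V (1\<^sub>m n)"
  have cancel1: "- (V * R) + (1\<^sub>m n + V * R) = 1\<^sub>m n"
    using V R by (intro eq_matI) auto
  have cancel2: "1\<^sub>m k + R * V + - (R * V) = 1\<^sub>m k"
    using V R by (intro eq_matI) auto
  have "?L1 * ?U1 = ?M"
    using V R by (subst mult_four_block_mat[of _ k k _ n _ n _ _ k _ n]) (simp_all add: cancel1)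
  moreover have "det (?L1 * ?U1) = det ?L1 * det ?U1"
    by (rule det_mult[of _ "k + n"]) (use V R in auto)
  moreover have "det ?L1 = 1"
    using V by (simp add: det_four_block_mat_upper_right_zero[where n = k and m = n])
  moreover have "det ?U1 = det (1\<^sub>m n + V * R)"
    using V R by (simp add: det_four_block_mat_lower_left_zero[where n = k and m = n])
  moreover have "?U2 * ?L2 = ?M"
    using V R by (subst mult_four_block_mat[of _ k k _ n _ n _ _ k _ n]) (simp_all add: cancel2)
  moreover have "det (?U2 * ?L2) = det ?U2 * det ?L2"
    by (rule det_mult[of _ "k + n"]) (use V R in auto)
  moreover have "det ?U2 = 1"
    using R by (simp add: det_four_block_mat_lower_left_zero[where n = k and m = n])
  moreover have "det ?L2 = det (1\<^sub>m k + R * V)"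
    using V R by (simp add: det_four_block_mat_upper_right_zero[where n = k and m = n])
  ultimately show ?thesis by simp
qed

text \<open>This is a count with multiplicity: if the second entry were below \<open>b\<close>, at
  most the first entry could reach \<open>b\<close>, whereas both \<open>a\<close> and
  \<open>b\<close> do.\<close>

lemma sorted_desc_second_ge:
  fixes xs :: "'a :: linorder list"
  assumes "sorted (rev xs)" and "{#a, b#} \<subseteq># mset xs" and "b \<le> a"
  shows "1 < length xs" and "b \<le> xs ! 1"
proof -
  have "size {#a, b#} \<le> size (mset xs)" using assms(2) by (rule size_mset_mono)
  then show "1 < length xs" by simp
  then obtain z y zs where xs: "xs = z # y # zs"
    by (metis Suc_length_conv less_iff_Suc_add add_Suc One_nat_def)
  show "b \<le> xs ! 1"
  proof (rule ccontr)
    assume "\<not> b \<le> xs ! 1"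
    then have less: "u < b" if "u \<in> set (y # zs)" for u
      using assms(1) that unfolding xs by (auto simp: sorted_append)
    have "filter (\<lambda>u. b \<le> u) (y # zs) = []"
      using less unfolding filter_empty_conv by (auto simp: not_le)
    then have "filter_mset (\<lambda>u. b \<le> u) (mset xs) = filter_mset (\<lambda>u. b \<le> u) {#z#}"
      unfolding xs mset_filter[symmetric] by (auto split: if_splits)
    moreover have "filter_mset (\<lambda>u. b \<le> u) {#a, b#} \<subseteq># filter_mset (\<lambda>u. b \<le> u) (mset xs)"
      using assms(2) by (rule multiset_filter_mono)
    ultimately have "size (filter_mset (\<lambda>u. b \<le> u) {#a, b#}) \<le> size (filter_mset (\<lambda>u. b \<le> u) {#z#})"
      using size_mset_mono by metis
    also have "\<dots> \<le> 1" by simp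
    finally show False using \<open>b \<le> a\<close> by simp
  qed
qed

text \<open>
  Subtracting \<open>t v v\<^sup>T\<close> from \<open>H\<close> moves the eigenvalue \<open>a\<close> to \<open>a - t\<close> and keeps the eigenpair
  \<open>(b, w)\<close>. Comparing the two characteristic polynomials yields the algebraic multiplicity \<open>2\<close>
  even when \<open>a = b\<close>.
\<close>

lemma eigenpair_mset_subseteq_proots_char_poly:
  fixes H :: "real mat"
  assumes H: "H \<in> carrier_mat n n" and v: "v \<in> carrier_vec n" and w: "w \<in> carrier_vec n"
    and Hv: "H *\<^sub>v v = a \<cdot>\<^sub>v v" and Hw: "H *\<^sub>v w = b \<cdot>\<^sub>v w"
    and vv: "scalar_prod v v = 1" and vw: "scalar_prod v w = 0" and w0: "w \<noteq> 0\<^sub>v n"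
  shows "{#a, b#} \<subseteq># proots (char_poly H)"
proof -
  \<comment> \<open>The shifted eigenvalue a - t must differ from both a and b, so that it can be
    told apart in the root multisets.\<close>
  define t :: real where "t = (if a - b = 1 then 2 else 1)"
  have t: "t \<noteq> 0" "a - t \<noteq> b" by (auto simp: t_def)
  define V where "V = mat_of_cols n [v]"
  define R where "R = mat_of_rows n [v]"
  have V: "V \<in> carrier_mat n 1" and R: "R \<in> carrier_mat 1 n" by (auto simp: V_def R_def)
  define H' where "H' = H + (- t) \<cdot>\<^sub>m (V * R)"
  have H': "H' \<in> carrier_mat n n" using H V R by (auto simp: H'_def)
  have VR: "(V * R) $$ (i, j) = v $ i * v $ j" if "i < n" "j < n" for i j
    using that v by (simp add: V_def R_def scalar_prod_def mat_of_cols_index mat_of_rows_index)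
  have RV: "R * V = 1\<^sub>m 1"
    using v vv by (intro eq_matI)
      (auto simp: V_def R_def scalar_prod_def mat_of_cols_index mat_of_rows_index)
  have HV: "(\<Sum>k<n. H $$ (i, k) * v $ k) = a * v $ i" if "i < n" for i
    using arg_cong[OF Hv, of "\<lambda>u. u $ i"] that v H
    by (simp add: scalar_prod_def atLeast0LessThan)
  \<comment> \<open>Since (x - H) v = (x - a) v, the matrix x - H' = x - H + t v v^T factors as (x -
    H) (1 + s v v^T) with s = t / (x - a). The second factor has determinant 1 + s.\<close>
  have char_poly_relation: "poly (char_poly H') x * (x - a) = poly (char_poly H) x * (x - (a - t))"
    if "x \<noteq> a" for x
  proof -
    define s where "s = t / (x - a)"
    have s: "s * (x - a) = t" using that by (simp add: s_def)
    define E where "E = 1\<^sub>m n + (s \<cdot>\<^sub>m V) * R"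
    define D where "D = - char_matrix H x"
    have E: "E \<in> carrier_mat n n" and D: "D \<in> carrier_mat n n"
      using H V R by (auto simp: E_def D_def)
    have E_index: "E $$ (i, j) = (if i = j then 1 else 0) + s * (v $ i * v $ j)" if "i < n" "j < n" for i j
      using that V R VR[OF that] unfolding E_def mult_smult_assoc_mat[OF V R] by simp
    have D_index: "D $$ (i, j) = (if i = j then x else 0) - H $$ (i, j)" if "i < n" "j < n" for i j
      using that H by (simp add: D_def char_matrix_def)
    have "- char_matrix H' x = D * E"
    proof (rule eq_matI)
      fix i j assume "i < dim_row (D * E)" "j < dim_col (D * E)"
      then have ij: "i < n" "j < n" using D E by auto
      have "(D * E) $$ (i, j) =
        (\<Sum>k<n. ((if i = k then x else 0) - H $$ (i, k)) * ((if k = j then 1 else 0) + s * (v $ k * v $ j)))"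
        using ij D E by (simp add: scalar_prod_def atLeast0LessThan D_index E_index)
      also have "\<dots> = (\<Sum>k<n. (if i = k then x else 0) * (if k = j then 1 else 0))
         + (\<Sum>k<n. (if i = k then x else 0) * (s * (v $ k * v $ j)))
         - (\<Sum>k<n. H $$ (i, k) * (if k = j then 1 else 0))
         - s * v $ j * (\<Sum>k<n. H $$ (i, k) * v $ k)"
        by (simp add: algebra_simps sum.distrib sum_subtractf sum_distrib_left)
      also have "\<dots> = (if i = j then x else 0) - H $$ (i, j) + (s * (x - a)) * (v $ i * v $ j)"
        unfolding HV[OF ij(1)] using ij by (simp add: algebra_simps if_distrib[of "\<lambda>u. u * _"] if_distrib[of "\<lambda>u. _ * u"]
          cong: if_cong)
      also have "\<dots> = (- char_matrix H' x) $$ (i, j)"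
        unfolding s using ij H V R VR[OF ij] by (simp add: char_matrix_def H'_def)
      finally show "(- char_matrix H' x) $$ (i, j) = (D * E) $$ (i, j)" by simp
    qed (use H' D E in \<open>auto simp: char_matrix_def\<close>)
    then have "poly (char_poly H') x = det (D * E)"
      by (simp add: char_poly_matrix[OF H'])
    also have "\<dots> = det (- char_matrix H x) * det (1\<^sub>m n + (s \<cdot>\<^sub>m V) * R)"
      using det_mult[OF D E] by (simp add: D_def E_def)
    also have "det (1\<^sub>m n + (s \<cdot>\<^sub>m V) * R) = det (1\<^sub>m 1 + R * (s \<cdot>\<^sub>m V))"
      by (rule det_one_plus_mult_commute) (use V R in auto)
    also have "R * (s \<cdot>\<^sub>m V) = s \<cdot>\<^sub>m 1\<^sub>m 1"
      using mult_smult_distrib[OF R V, of s] RV by simp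
    also have "det (1\<^sub>m 1 + s \<cdot>\<^sub>m 1\<^sub>m 1) = 1 + s"
      by (subst det_single) auto
    finally have "poly (char_poly H') x = poly (char_poly H) x * (1 + s)"
      by (simp add: char_poly_matrix[OF H])
    moreover have "(1 + s) * (x - a) = x - (a - t)" using s by (simp add: algebra_simps)
    ultimately show ?thesis by (simp add: mult.assoc)
  qed
  \<comment> \<open>The relation is only known for x different from a. One more factor x - a makes
    both sides vanish at a, and it is cancelled afterwards.\<close>
  have "char_poly H' * [:- a, 1:] * [:- a, 1:] = char_poly H * [:- (a - t), 1:] * [:- a, 1:]"
  proof (rule poly_eq_poly_eq_iff[THEN iffD1], rule ext)
    fix x
    have "poly (char_poly H' * [:- a, 1:] * [:- a, 1:]) x = (poly (char_poly H') x * (x - a)) * (x - a)"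
      by (simp add: algebra_simps)
    also have "\<dots> = (poly (char_poly H) x * (x - (a - t))) * (x - a)"
      using char_poly_relation[of x] by (cases "x = a") simp_all
    also have "\<dots> = poly (char_poly H * [:- (a - t), 1:] * [:- a, 1:]) x"
      by (simp add: algebra_simps)
    finally show "poly (char_poly H' * [:- a, 1:] * [:- a, 1:]) x =
      poly (char_poly H * [:- (a - t), 1:] * [:- a, 1:]) x" .
  qed
  then have cp: "char_poly H' * [:- a, 1:] = char_poly H * [:- (a - t), 1:]"
    by (simp del: mult_pCons_right)
  have nz: "char_poly H' \<noteq> 0" "char_poly H \<noteq> 0"
    using degree_monic_char_poly[OF H] degree_monic_char_poly[OF H'] by auto
  have H'_index: "H' $$ (i, k) = H $$ (i, k) - t * (v $ i * v $ k)" if "i < n" "k < n" for i k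
    using that H V R VR[OF that] by (simp add: H'_def)
  have "H' *\<^sub>v w = b \<cdot>\<^sub>v w"
  proof (rule eq_vecI)
    fix i assume "i < dim_vec (b \<cdot>\<^sub>v w)"
    then have i: "i < n" using w by simp
    have "(H' *\<^sub>v w) $ i = (\<Sum>k<n. H $$ (i, k) * w $ k) - t * v $ i * (\<Sum>k<n. v $ k * w $ k)"
      using i H' w by (simp add: H'_index scalar_prod_def atLeast0LessThan algebra_simps
        sum.distrib sum_subtractf sum_distrib_left)
    also have "(\<Sum>k<n. v $ k * w $ k) = 0"
      using vw w by (simp add: scalar_prod_def atLeast0LessThan)
    also have "(\<Sum>k<n. H $$ (i, k) * w $ k) = b * w $ i"
      using arg_cong[OF Hw, of "\<lambda>u. u $ i"] i w H
      by (simp add: scalar_prod_def atLeast0LessThan)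
    finally show "(H' *\<^sub>v w) $ i = (b \<cdot>\<^sub>v w) $ i" using i w by simp
  qed (use H' w in auto)
  then have "eigenvalue H' b"
    using w w0 H' unfolding eigenvalue_def eigenvector_def by auto
  then have "poly (char_poly H') b = 0" by (simp add: eigenvalue_root_char_poly[OF H'])
  then have "b \<in># proots (char_poly H')" using nz by simp
  then obtain P where P: "proots (char_poly H') = add_mset b P" by (metis multi_member_split)
  \<comment> \<open>The roots of H', among them b, together with a are the roots of H together with
    a - t. As a - t is neither a nor b, cancelling it leaves both a and b among the roots of
    H.\<close>
  have "proots (char_poly H') + {#a#} = proots (char_poly H) + {#a - t#}"
    using arg_cong[OF cp, of proots] nz proots_linear_factor[of a] proots_linear_factor[of "a - t"]
    by (subst (asm) (1 2) proots_mult) auto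
  then have eq: "add_mset a (add_mset b P) = add_mset (a - t) (proots (char_poly H))"
    by (simp add: P)
  have "a - t \<in># add_mset a (add_mset b P)" unfolding eq by simp
  then have "a - t \<in># P" using t by auto
  then obtain P' where "P = add_mset (a - t) P'" by (metis multi_member_split)
  then have "proots (char_poly H) = {#a, b#} + P'" using eq by (simp add: add_mset_commute)
  then show ?thesis by simp
qed


text \<open>One half of the Courant-Fischer principle. The maximum l of |G y|^2 on the unit sphere
  of the complement of the all-ones vector is an eigenvalue of G^T G with an eigenvector orthogonal
  to the top one, so sqrt l occurs in the list of singular values besides sigma_1.\<close>

lemma L2_set_mult_le_sing_val_2:
  fixes y :: "nat \<Rightarrow> real"
  assumes G: "G \<in> carrier_mat m n" and m: "0 < m" and n: "0 < n"
    and top: "top_singular_vectors G ((1 / sqrt (real m)) \<cdot>\<^sub>v ones_vec m)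
      ((1 / sqrt (real n)) \<cdot>\<^sub>v ones_vec n)"
    and y: "(\<Sum>j<n. y j) = 0"
  shows "L2_set (\<lambda>i. \<Sum>j<n. G $$ (i, j) * y j) {..<m} \<le> sing_val 2 G * L2_set y {..<n}"
proof (cases "(\<Sum>j<n. (y j)\<^sup>2) = 0")
  case True
  then have "y j = 0" if "j < n" for j
    using that by (simp add: sum_nonneg_eq_0_iff)
  then show ?thesis by (simp add: L2_set_def)
next
  case False
  define \<sigma> where "\<sigma> = sing_val 1 G"
  define u v where "u = (1 / sqrt (real m)) \<cdot>\<^sub>v ones_vec m" and "v = (1 / sqrt (real n)) \<cdot>\<^sub>v ones_vec n"
  have uv: "u \<in> carrier_vec m" "v \<in> carrier_vec n" by (auto simp: u_def v_def ones_vec_def)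
  have vv: "scalar_prod v v = 1" and Gv: "G *\<^sub>v v = \<sigma> \<cdot>\<^sub>v u" and Gu: "transpose_mat G *\<^sub>v u = \<sigma> \<cdot>\<^sub>v v"
    using top unfolding top_singular_vectors_def u_def v_def \<sigma>_def by blast+
  have row: "(\<Sum>j<n. G $$ (i, j)) = \<sigma> * sqrt n / sqrt m" if "i < m" for i
  proof -
    have "(\<Sum>j<n. G $$ (i, j) * (1 / sqrt n)) = \<sigma> / sqrt m"
      using arg_cong[OF Gv, of "\<lambda>z. z $ i"] that G
      by (simp add: u_def v_def ones_vec_def scalar_prod_def atLeast0LessThan)
    then have "(\<Sum>j<n. G $$ (i, j)) / sqrt n = \<sigma> / sqrt m"
      by (simp flip: sum_divide_distrib)
    then show ?thesis using n by (simp add: nonzero_divide_eq_eq)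
  qed
  have col: "(\<Sum>i<m. G $$ (i, j)) = \<sigma> * sqrt m / sqrt n" if "j < n" for j
  proof -
    have "(\<Sum>i<m. G $$ (i, j) * (1 / sqrt m)) = \<sigma> / sqrt n"
      using arg_cong[OF Gu, of "\<lambda>z. z $ j"] that G
      by (simp add: u_def v_def ones_vec_def scalar_prod_def atLeast0LessThan)
    then have "(\<Sum>i<m. G $$ (i, j)) / sqrt m = \<sigma> / sqrt n"
      by (simp flip: sum_divide_distrib)
    then show ?thesis using m by (simp add: nonzero_divide_eq_eq)
  qed
  \<comment> \<open>The unnormalised all-ones vector replaces \<open>v\<close> here, as
    orthogonality to it is just a vanishing sum of entries.\<close>
  have ev: "(\<Sum>i<m. G $$ (i, j) * (\<Sum>j'<n. G $$ (i, j') * 1)) = \<sigma>\<^sup>2 * 1" if "j < n" for j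
  proof -
    have "(\<Sum>i<m. G $$ (i, j) * (\<Sum>j'<n. G $$ (i, j') * 1)) =
        (\<Sum>i<m. G $$ (i, j)) * (\<sigma> * sqrt n / sqrt m)"
      by (simp add: row sum_distrib_right sum_divide_distrib)
    also have "\<dots> = \<sigma>\<^sup>2 * 1"
      using m n by (simp add: col[OF that] power2_eq_square)
    finally show ?thesis .
  qed
  \<comment> \<open>The given non-zero \<open>y\<close> shows that the complement is non-trivial,
    which excludes \<open>n = 1\<close>.\<close>
  obtain w l where w: "(\<Sum>j<n. (w j)\<^sup>2) = 1" "(\<Sum>j<n. w j * 1) = 0"
    and l: "(\<Sum>i<m. (\<Sum>j<n. G $$ (i, j) * w j)\<^sup>2) = l"
    and max: "\<And>y. (\<Sum>j<n. y j * 1) = 0 \<Longrightarrow>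
      (\<Sum>i<m. (\<Sum>j<n. G $$ (i, j) * y j)\<^sup>2) \<le> l * (\<Sum>j<n. (y j)\<^sup>2)"
    by (rule ex_max_quadratic_form_orthogonal[where z = y and v = "\<lambda>_. 1" and n = n and m = m
          and A = "\<lambda>i j. G $$ (i, j)"])
       (use y False in \<open>auto intro: that\<close>)
  have eig: "(\<Sum>i<m. G $$ (i, j) * (\<Sum>j'<n. G $$ (i, j') * w j')) = l * w j" if "j < n" for j
    by (rule maximizer_orthogonal_eigenvector[OF w l max ev that])
  have l0: "0 \<le> l" unfolding l[symmetric] by (simp add: sum_nonneg)
  define H where "H = transpose_mat G * G"
  have H: "H \<in> carrier_mat n n" using G by (simp add: H_def)
  have H_mult: "H *\<^sub>v z = transpose_mat G *\<^sub>v (G *\<^sub>v z)" if "z \<in> carrier_vec n" for z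
    unfolding H_def using G that by (intro assoc_mult_mat_vec) auto
  have Hv: "H *\<^sub>v v = \<sigma>\<^sup>2 \<cdot>\<^sub>v v"
  proof -
    have "transpose_mat G *\<^sub>v (\<sigma> \<cdot>\<^sub>v u) = \<sigma> \<cdot>\<^sub>v (transpose_mat G *\<^sub>v u)"
      using G uv by (intro mult_mat_vec) auto
    then show ?thesis
      by (simp add: H_mult uv Gv Gu smult_smult_assoc power2_eq_square)
  qed
  define w' where "w' = Matrix.vec n w"
  have w': "w' \<in> carrier_vec n" by (simp add: w'_def)
  have Hw: "H *\<^sub>v w' = l \<cdot>\<^sub>v w'"
  proof (rule eq_vecI)
    fix j assume "j < dim_vec (l \<cdot>\<^sub>v w')"
    then have j: "j < n" by (simp add: w'_def)
    have "(H *\<^sub>v w') $ j = (\<Sum>i<m. G $$ (i, j) * (\<Sum>j'<n. G $$ (i, j') * w j'))"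
      unfolding H_mult[OF w'] using j G
      by (simp add: scalar_prod_def atLeast0LessThan w'_def)
    then show "(H *\<^sub>v w') $ j = (l \<cdot>\<^sub>v w') $ j" using eig[OF j] j by (simp add: w'_def)
  qed (use H in \<open>simp add: w'_def\<close>)
  have vw: "scalar_prod v w' = 0"
    using w(2) by (simp add: v_def w'_def ones_vec_def scalar_prod_def atLeast0LessThan
      flip: sum_divide_distrib)
  have "w' \<noteq> 0\<^sub>v n"
  proof
    assume "w' = 0\<^sub>v n"
    then have "w j = 0" if "j < n" for j using that unfolding w'_def by (metis index_vec index_zero_vec(1))
    then show False using w(1) by simp
  qed
  then have sub: "{#\<sigma>\<^sup>2, l#} \<subseteq># proots (char_poly H)"
    by (rule eigenpair_mset_subseteq_proots_char_poly[OF H uv(2) w' Hv Hw vv vw])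
  define L where "L = singular_values G"
  have mset_L: "mset L = image_mset sqrt (proots (char_poly H))"
    by (simp add: L_def singular_values_def H_def)
  have sorted_L: "sorted (rev L)" by (simp add: L_def singular_values_def)
  have sub_L: "{#sqrt (\<sigma>\<^sup>2), sqrt l#} \<subseteq># mset L"
    unfolding mset_L using image_mset_subseteq_mono[OF sub, of sqrt] by simp
  then have in_L: "sqrt (\<sigma>\<^sup>2) \<in> set L" "sqrt l \<in> set L"
    by (metis mset_subset_eqD set_mset_mset union_single_eq_member add_mset_commute)+
  then have "L \<noteq> []" by auto
  then have \<sigma>_L: "\<sigma> = L ! 0" by (simp add: \<sigma>_def sing_val_def L_def)
  have "x \<le> L ! 0" if "x \<in> set L" for x
    using sorted_L that by (cases L) (auto simp: sorted_append)
  \<comment> \<open>The order of the two values comes for free: sigma is the head of the decreasing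
    list in which sqrt l occurs.\<close>
  then have "sqrt l \<le> sqrt (\<sigma>\<^sup>2)" using in_L \<sigma>_L by fastforce
  from sorted_desc_second_ge[OF sorted_L sub_L this]
  have "sqrt l \<le> sing_val 2 G" by (simp add: sing_val_def L_def)
  have "L2_set (\<lambda>i. \<Sum>j<n. G $$ (i, j) * y j) {..<m} \<le> sqrt (l * (\<Sum>j<n. (y j)\<^sup>2))"
    unfolding L2_set_def using max[of y] y by (intro real_sqrt_le_mono) simp
  also have "\<dots> = sqrt l * L2_set y {..<n}" by (simp add: real_sqrt_mult L2_set_def)
  also have "\<dots> \<le> sing_val 2 G * L2_set y {..<n}"
    using \<open>sqrt l \<le> sing_val 2 G\<close> by (intro mult_right_mono) (auto simp: L2_set_nonneg)
  finally show ?thesis .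
qed

section \<open>From the matrix rank to a factorisation\<close>

lemma rank_le_mono:
  assumes "rank_le m n k A" and "k \<le> k'"
  shows "rank_le m n k' A"
proof -
  obtain a b where A: "\<And>i j. i < m \<Longrightarrow> j < n \<Longrightarrow> A i j = (\<Sum>l<k. a l i * b l j)"
    using assms unfolding rank_le_def by blast
  have "(\<Sum>l<k'. (if l < k then a l i else 0) * b l j) = (\<Sum>l<k. a l i * b l j)" for i j
    using \<open>k \<le> k'\<close> by (intro sum.mono_neutral_cong_right) auto
  then show ?thesis unfolding rank_le_def
    by (intro exI[of _ "\<lambda>l i. if l < k then a l i else 0"] exI[of _ b]) (simp add: A)
qed

text \<open>A maximal independent set \<open>S\<close> of columns has as many elements as the rank
  and, by maximality, spans every column. Its members are the left factors, and the coordinates of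
  the columns are the right ones.\<close>

lemma rank_le_if_mat_rank_le:
  assumes A: "A \<in> carrier_mat m n" and "mat_rank A \<le> k"
  shows "rank_le m n k (\<lambda>i j. A $$ (i, j))"
proof -
  interpret vec_space "TYPE(real)" m .
  let ?P = "\<lambda>T. T \<subseteq> set (cols A) \<and> lin_indpt T"
  have cols: "set (cols A) \<subseteq> carrier_vec m" using A cols_dim by blast
  have "?P {}" using lin_dep_def by auto
  then obtain S where S: "finite S" "maximal S ?P"
    using maximal_exists_superset[of "set (cols A)" ?P "{}"] by auto
  have card_S: "card S \<le> k"
    using rank_card_indpt[OF A S(2)] assms by simp
  have S_cols: "S \<subseteq> set (cols A)" and indpt: "lin_indpt S"
    using S(2) by (simp_all add: maximal_def)
  then have S_carrier: "S \<subseteq> carrier_vec m" using cols by blast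
  have "\<exists>c. \<forall>i<m. A $$ (i, j) = (\<Sum>x\<in>S. c x * x $ i)" if j: "j < n" for j
  proof -
    have col: "col A j \<in> set (cols A)" using j A by (simp add: cols_def)
    have "col A j \<in> span S"
    proof (cases "col A j \<in> S")
      case True
      then show ?thesis using in_own_span[OF S_carrier] by blast
    next
      case False
      then have "\<not> ?P (insert (col A j) S)"
        using S(2) unfolding maximal_def by blast
      then have "lin_dep (S \<union> {col A j})" using S_cols col by simp
      then show ?thesis
        using lin_dep_iff_in_span[OF S_carrier indpt _ False] col cols by blast
    qed
    from in_spanE[OF this] obtain c T where c: "col A j = lincomb c T" "finite T" "T \<subseteq> S"
      by (elim exE conjE) (rule that)
    have "A $$ (i, j) = (\<Sum>x\<in>S. (if x \<in> T then c x else 0) * x $ i)" if "i < m" for i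
    proof -
      have "A $$ (i, j) = lincomb c T $ i" using that j A c(1) by (metis index_col carrier_matD)
      also have "\<dots> = (\<Sum>x\<in>T. c x * x $ i)"
        using that c(3) S_carrier by (intro lincomb_index) auto
      also have "\<dots> = (\<Sum>x\<in>S. (if x \<in> T then c x else 0) * x $ i)"
        using S(1) c(3) by (intro sum.mono_neutral_cong_left) auto
      finally show ?thesis .
    qed
    then show ?thesis by (intro exI[of _ "\<lambda>x. if x \<in> T then c x else 0"] allI impI)
  qed
  then have "\<forall>j\<in>{..<n}. \<exists>c. \<forall>i<m. A $$ (i, j) = (\<Sum>x\<in>S. c x * x $ i)" by simp
  then have "\<exists>c. \<forall>j\<in>{..<n}. \<forall>i<m. A $$ (i, j) = (\<Sum>x\<in>S. c j x * x $ i)" by (rule bchoice)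
  then obtain c where "\<forall>j\<in>{..<n}. \<forall>i<m. A $$ (i, j) = (\<Sum>x\<in>S. c j x * x $ i)" ..
  then have c: "A $$ (i, j) = (\<Sum>x\<in>S. c j x * x $ i)" if "i < m" "j < n" for i j
    using that by simp
  obtain e where e: "bij_betw e {..<card S} S"
    using ex_bij_betw_nat_finite[OF S(1)] by (auto simp: atLeast0LessThan)
  have "A $$ (i, j) = (\<Sum>l<card S. e l $ i * c j (e l))" if "i < m" "j < n" for i j
    unfolding c[OF that] using sum.reindex_bij_betw[OF e, of "\<lambda>x. c j x * x $ i"]
    by (simp add: mult.commute)
  then have "rank_le m n (card S) (\<lambda>i j. A $$ (i, j))"
    unfolding rank_le_def
    by (intro exI[of _ "\<lambda>l i. e l $ i"] exI[of _ "\<lambda>l j. c j (e l)"]) simp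
  then show ?thesis using card_S by (rule rank_le_mono)
qed

section \<open>Concentration of the noise matrix\<close>

text \<open>Extensional functions make this a finite set, and integer points can be counted by a
  generating function instead of a volume argument.\<close>

definition lattice_ball :: "nat \<Rightarrow> (nat \<Rightarrow> int) set" where
  "lattice_ball n = {k \<in> PiE {..<n} (\<lambda>_. UNIV). (\<Sum>j<n. (k j)\<^sup>2) \<le> 4 * int n}"

lemma sum_half_power_abs: "(\<Sum>x\<in>{- int B..int B}. (1/2::real) ^ nat \<bar>x\<bar>) = 3 - 2 * (1/2) ^ B"
proof (induction B)
  case (Suc B)
  have "{- int (Suc B)..int (Suc B)} = insert (- int (Suc B)) (insert (int (Suc B)) {- int B..int B})"
    by auto
  then show ?case using Suc.IH by (simp add: nat_add_distrib)
qed simp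

text \<open>Each point k gets the weight 2^(- sum of |k_j|). As |x| <= x^2 for integers, a point of
  the ball weighs at least 2^(- 4 n) = 16^(- n), while a whole box weighs at most 3^n, because the
  two-sided geometric series sums to 3.\<close>

lemma card_lattice_ball: "finite (lattice_ball n)" "real (card (lattice_ball n)) \<le> 48 ^ n"
proof -
  \<comment> \<open>Every coordinate in the ball satisfies |k_j| <= k_j^2 <= 4 n, so the box of this
    half-width contains the ball.\<close>
  define B where "B = 4 * n"
  define P where "P = PiE {..<n} (\<lambda>_. {- int B..int B})"
  define wt where "wt k = (\<Prod>j<n. (1/2::real) ^ nat \<bar>k j\<bar>)" for k :: "nat \<Rightarrow> int"
  have le_square: "\<bar>x\<bar> \<le> x\<^sup>2" for x :: int
    using self_le_power[of "\<bar>x\<bar>" 2] by (cases "x = 0") auto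
  have sub: "lattice_ball n \<subseteq> P"
  proof
    fix k assume k: "k \<in> lattice_ball n"
    have "k j \<in> {- int B..int B}" if "j < n" for j
    proof -
      have "\<bar>k j\<bar> \<le> (k j)\<^sup>2" by (rule le_square)
      also have "\<dots> \<le> (\<Sum>j<n. (k j)\<^sup>2)" using that by (intro member_le_sum) auto
      also have "\<dots> \<le> int B" using k by (simp add: lattice_ball_def B_def)
      finally show ?thesis by auto
    qed
    then show "k \<in> P" using k by (auto simp: P_def lattice_ball_def PiE_iff)
  qed
  have fin: "finite P" by (simp add: P_def finite_PiE)
  show "finite (lattice_ball n)" using sub fin by (rule finite_subset)
  have wt_ge: "1 \<le> 16 ^ n * wt k" if k: "k \<in> lattice_ball n" for k
  proof -
    have "(\<Sum>j<n. nat \<bar>k j\<bar>) \<le> 4 * n"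
    proof -
      have "int (\<Sum>j<n. nat \<bar>k j\<bar>) = (\<Sum>j<n. \<bar>k j\<bar>)" by simp
      also have "\<dots> \<le> (\<Sum>j<n. (k j)\<^sup>2)" by (intro sum_mono le_square)
      also have "\<dots> \<le> int (4 * n)" using k by (simp add: lattice_ball_def)
      finally show ?thesis by linarith
    qed
    then have "(1/2::real) ^ (4 * n) \<le> wt k"
      by (simp add: wt_def flip: power_sum)
    moreover have "(16::real) ^ n * (1/2) ^ (4 * n) = 1"
    proof -
      have "(16::real) ^ n * (1/2) ^ (4 * n) = (16 * (1/2) ^ 4) ^ n"
        by (simp only: power_mult power_mult_distrib)
      also have "(16::real) * (1/2) ^ 4 = 1" by (simp add: power_divide)
      finally show ?thesis by simp
    qed
    ultimately show ?thesis
      using mult_left_mono[of "(1/2::real) ^ (4 * n)" "wt k" "16 ^ n"] by simp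
  qed
  have "real (card (lattice_ball n)) = (\<Sum>k\<in>lattice_ball n. 1)" by simp
  also have "\<dots> \<le> (\<Sum>k\<in>lattice_ball n. 16 ^ n * wt k)" by (intro sum_mono wt_ge)
  also have "\<dots> \<le> (\<Sum>k\<in>P. 16 ^ n * wt k)"
    using sub fin by (intro sum_mono2) (auto simp: wt_def intro!: mult_nonneg_nonneg prod_nonneg)
  also have "\<dots> = 16 ^ n * (\<Prod>j<n. \<Sum>x\<in>{- int B..int B}. (1/2::real) ^ nat \<bar>x\<bar>)"
    unfolding P_def wt_def by (subst prod_sum_PiE) (auto simp: sum_distrib_left)
  also have "\<dots> = 16 ^ n * (3 - 2 * (1/2) ^ B) ^ n"
    unfolding sum_half_power_abs by simp
  also have "\<dots> \<le> 16 ^ n * 3 ^ n"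
    using power_le_one[of "1/2::real" B] by (intro mult_left_mono power_mono) auto
  also have "\<dots> = (16 * 3) ^ n" by (rule power_mult_distrib[symmetric])
  also have "\<dots> = 48 ^ n" by simp
  finally show "real (card (lattice_ball n)) \<le> 48 ^ n" .
qed

text \<open>
  Rounding \<open>2 \<surd>n a / \<parallel>a\<parallel>\<close> towards \<open>0\<close> gives a point of the lattice ball at distance at
  most \<open>\<surd>n\<close>, so the lattice ball, scaled down by \<open>2 \<surd>n\<close>, is a \<open>1/2\<close>-net of the unit sphere.
\<close>

lemma L2_set_le_if_lattice_ball:
  assumes n: "0 < n"
    and net: "\<And>k. k \<in> lattice_ball n \<Longrightarrow> (\<Sum>j<n. a j * real_of_int (k j)) \<le> 2 * sqrt (real n) * M"
  shows "L2_set a {..<n} \<le> 2 * M"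
proof (cases "L2_set a {..<n} = 0")
  case True
  \<comment> \<open>Testing the hypothesis at the origin yields that M is non-negative.\<close>
  have "restrict (\<lambda>_. 0) {..<n} \<in> lattice_ball n" by (simp add: lattice_ball_def)
  from net[OF this] have "0 \<le> 2 * sqrt (real n) * M" by simp
  then show ?thesis using True n by (simp add: zero_le_mult_iff)
next
  case False
  define A where "A = L2_set a {..<n}"
  have A: "A > 0" using False by (simp add: A_def L2_set_nonneg order_less_le)
  have A2: "(\<Sum>j<n. (a j)\<^sup>2) = A\<^sup>2" by (simp add: A_def L2_set_def sum_nonneg)
  define y where "y j = 2 * sqrt n * a j / A" for j
  \<comment> \<open>Rounding to the nearest integer could leave the ball. Truncation never increases
    an absolute value, at the price of an error up to 1 in each coordinate.\<close>
  define tr :: "real \<Rightarrow> int" where "tr x = (if x \<ge> 0 then \<lfloor>x\<rfloor> else \<lceil>x\<rceil>)" for x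
  have tr1: "\<bar>real_of_int (tr x)\<bar> \<le> \<bar>x\<bar>" for x
  proof (cases "x \<ge> 0")
    case True
    then show ?thesis by (simp add: tr_def)
  next
    case False
    then have "real_of_int \<lceil>x\<rceil> \<le> 0" by simp
    then show ?thesis using False le_of_int_ceiling[of x] by (simp add: tr_def)
  qed
  have tr2: "\<bar>x - real_of_int (tr x)\<bar> \<le> 1" for x
    unfolding tr_def abs_le_iff by (cases "x \<ge> 0") (simp_all, linarith+)
  define k where "k = restrict (\<lambda>j. tr (y j)) {..<n}"
  have "(\<Sum>j<n. (y j)\<^sup>2) = 4 * n"
  proof -
    have "(\<Sum>j<n. (y j)\<^sup>2) = 4 * n * (\<Sum>j<n. (a j)\<^sup>2) / A\<^sup>2"
      by (simp add: y_def power_mult_distrib power_divide sum_divide_distrib sum_distrib_left)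
    then show ?thesis using A A2 by simp
  qed
  moreover have "(\<Sum>j<n. (real_of_int (k j))\<^sup>2) \<le> (\<Sum>j<n. (y j)\<^sup>2)"
    by (intro sum_mono) (use tr1 in \<open>simp add: k_def abs_le_square_iff\<close>)
  ultimately have "real_of_int (\<Sum>j<n. (k j)\<^sup>2) \<le> real_of_int (4 * int n)" by simp
  then have "k \<in> lattice_ball n"
    unfolding of_int_le_iff by (simp add: lattice_ball_def k_def)
  then have ak: "(\<Sum>j<n. a j * real_of_int (k j)) \<le> 2 * sqrt n * M" by (rule net)
  have "(\<Sum>j<n. (y j - k j)\<^sup>2) \<le> (\<Sum>j<n. 1)"
    by (intro sum_mono) (use tr2 in \<open>simp add: k_def abs_square_le_1\<close>)
  then have "L2_set (\<lambda>j. y j - k j) {..<n} \<le> sqrt n" by (simp add: L2_set_def)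
  then have diff: "(\<Sum>j<n. a j * (y j - k j)) \<le> A * sqrt n"
    using abs_sum_mult_le_L2_set[of a "\<lambda>j. y j - k j" "{..<n}"] A
      mult_left_mono[of "L2_set (\<lambda>j. y j - k j) {..<n}" "sqrt n" A]
    unfolding A_def by linarith
  have "(\<Sum>j<n. a j * y j) = 2 * sqrt n * (\<Sum>j<n. (a j)\<^sup>2) / A"
    by (simp add: y_def sum_divide_distrib sum_distrib_left power2_eq_square mult_ac)
  then have "(\<Sum>j<n. a j * y j) = 2 * sqrt n * A" using A A2 by (simp add: power2_eq_square)
  \<comment> \<open>The exact value 2 sqrt n A exceeds the value at the net point by at most sqrt n
    A, half of it, so the other half is bounded by 2 sqrt n M.\<close>
  then have "2 * sqrt n * A \<le> 2 * sqrt n * M + A * sqrt n"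
    using ak diff by (simp add: right_diff_distrib sum_subtractf)
  then have "sqrt n * A \<le> sqrt n * (2 * M)" by (simp add: algebra_simps)
  then show ?thesis using n by (simp add: A_def)
qed

text \<open>The net is applied once on each side and costs a factor 2 each time: first to the rows
  k^T Z for lattice points k, then to Z y for arbitrary y, by k^T Z y <= |k^T Z| |y|.\<close>

lemma op_bound_if_lattice_ball:
  assumes m: "0 < m" and n: "0 < n"
    and net: "\<And>k l. k \<in> lattice_ball m \<Longrightarrow> l \<in> lattice_ball n \<Longrightarrow>
      (\<Sum>i<m. \<Sum>j<n. real_of_int (k i) * real_of_int (l j) * Z i j) \<le> 4 * sqrt (real m) * sqrt (real n) * M"
  shows "op_bound m n Z (4 * M)"
  unfolding op_bound_def
proof
  fix y :: "nat \<Rightarrow> real"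
  have row: "L2_set (\<lambda>j. \<Sum>i<m. real_of_int (k i) * Z i j) {..<n} \<le> 2 * (2 * sqrt m * M)"
    if k: "k \<in> lattice_ball m" for k
  proof (rule L2_set_le_if_lattice_ball[OF n])
    fix l assume l: "l \<in> lattice_ball n"
    have "(\<Sum>j<n. (\<Sum>i<m. real_of_int (k i) * Z i j) * real_of_int (l j)) =
        (\<Sum>j<n. \<Sum>i<m. real_of_int (k i) * real_of_int (l j) * Z i j)"
      unfolding sum_distrib_right by (simp add: mult_ac)
    also have "\<dots> \<le> 2 * sqrt n * (2 * sqrt m * M)"
      using net[OF k l] by (subst sum.swap) (simp add: mult_ac)
    finally show "(\<Sum>j<n. (\<Sum>i<m. real_of_int (k i) * Z i j) * real_of_int (l j))
      \<le> 2 * sqrt n * (2 * sqrt m * M)" .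
  qed
  have "L2_set (\<lambda>i. \<Sum>j<n. Z i j * y j) {..<m} \<le> 2 * (2 * M * L2_set y {..<n})"
  proof (rule L2_set_le_if_lattice_ball[OF m])
    fix k assume k: "k \<in> lattice_ball m"
    have "(\<Sum>i<m. (\<Sum>j<n. Z i j * y j) * real_of_int (k i)) =
        (\<Sum>i<m. \<Sum>j<n. real_of_int (k i) * Z i j * y j)"
      unfolding sum_distrib_right by (simp add: mult_ac)
    also have "\<dots> = (\<Sum>j<n. (\<Sum>i<m. real_of_int (k i) * Z i j) * y j)"
      by (subst sum.swap) (simp add: sum_distrib_right)
    also have "\<dots> \<le> L2_set (\<lambda>j. \<Sum>i<m. real_of_int (k i) * Z i j) {..<n} * L2_set y {..<n}"
      by (rule abs_le_D1[OF abs_sum_mult_le_L2_set])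
    also have "\<dots> \<le> 2 * (2 * sqrt m * M) * L2_set y {..<n}"
      by (intro mult_right_mono row k L2_set_nonneg)
    finally show "(\<Sum>i<m. (\<Sum>j<n. Z i j * y j) * real_of_int (k i))
      \<le> 2 * sqrt m * (2 * M * L2_set y {..<n})" by (simp add: mult_ac)
  qed
  then show "L2_set (\<lambda>i. \<Sum>j<n. Z i j * y j) {..<m} \<le> 4 * M * L2_set y {..<n}" by simp
qed

section \<open>Hoeffding's inequality and the union bound over the net\<close>

lemma prob_weighted_sum_Pi_pmf_ge:
  fixes g :: "'e \<Rightarrow> 'y \<Rightarrow> real"
  assumes fin: "finite \<Omega>" and L: "0 < L" and B: "0 < B" and eps: "0 < \<epsilon>"
    and mean: "\<And>e. e \<in> \<Omega> \<Longrightarrow> measure_pmf.expectation (D e) (g e) = 0"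
    and bound: "\<And>e y. e \<in> \<Omega> \<Longrightarrow> y \<in> set_pmf (D e) \<Longrightarrow> \<bar>g e y\<bar> \<le> L"
    and c: "(\<Sum>e\<in>\<Omega>. (c e)\<^sup>2) \<le> B"
  shows "measure_pmf.prob (Pi_pmf \<Omega> dflt D) {Y. \<epsilon> \<le> (\<Sum>e\<in>\<Omega>. c e * g e (Y e))}
    \<le> exp (- \<epsilon>\<^sup>2 / (2 * B * L\<^sup>2))"
\<comment> \<open>If all weights vanish, the denominator in Hoeffding's exponent is 0; the event is
  then empty because \<open>\<epsilon>\<close> is positive.\<close>
proof (cases "(\<Sum>e\<in>\<Omega>. (c e)\<^sup>2) = 0")
  case True
  then have "c e = 0" if "e \<in> \<Omega>" for e using that fin by (simp add: sum_nonneg_eq_0_iff)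
  then have "(\<Sum>e\<in>\<Omega>. c e * g e (Y e)) = 0" for Y by (intro sum.neutral) auto
  then show ?thesis using eps by simp
next
  case False
  define S where "S = (\<Sum>e\<in>\<Omega>. (c e)\<^sup>2)"
  have S: "0 < S" "S \<le> B" using False c by (auto simp: S_def sum_nonneg order_less_le)
  let ?P = "Pi_pmf \<Omega> dflt D"
  let ?X = "\<lambda>e Y. c e * g e (Y e)"
  interpret Hoeffding_ineq "measure_pmf ?P" \<Omega> ?X "\<lambda>e. - (\<bar>c e\<bar> * L)" "\<lambda>e. \<bar>c e\<bar> * L"
    "\<Sum>e\<in>\<Omega>. measure_pmf.expectation ?P (?X e)"
  proof unfold_locales
    show "prob_space.indep_vars (measure_pmf ?P) (\<lambda>_. borel) ?X \<Omega>"
      by (rule prob_space.indep_vars_compose2[OF measure_pmf.prob_space_axioms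
            indep_vars_Pi_pmf[OF fin], where Y = "\<lambda>e y. c e * g e y"]) simp
  next
    fix e assume e: "e \<in> \<Omega>"
    show "AE Y in measure_pmf ?P. ?X e Y \<in> {- (\<bar>c e\<bar> * L)..\<bar>c e\<bar> * L}"
      unfolding AE_measure_pmf_iff
    proof
      fix Y assume "Y \<in> set_pmf ?P"
      then have "Y e \<in> set_pmf (D e)" using e fin by (auto simp: set_Pi_pmf PiE_dflt_def)
      then have "\<bar>?X e Y\<bar> \<le> \<bar>c e\<bar> * L"
        using bound[OF e] by (simp add: abs_mult mult_left_mono)
      then show "?X e Y \<in> {- (\<bar>c e\<bar> * L)..\<bar>c e\<bar> * L}" by auto
    qed
  qed (use fin in auto)
  have "measure_pmf.expectation ?P (?X e) = 0" if e: "e \<in> \<Omega>" for e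
  proof -
    have "measure_pmf.expectation ?P (?X e) = measure_pmf.expectation (map_pmf (\<lambda>Y. Y e) ?P) (\<lambda>y. c e * g e y)"
      by simp
    also have "map_pmf (\<lambda>Y. Y e) ?P = D e" using e fin by (simp add: Pi_pmf_component)
    finally show ?thesis using mean[OF e] by simp
  qed
  then have mu: "(\<Sum>e\<in>\<Omega>. measure_pmf.expectation ?P (?X e)) = 0" by simp
  have width: "(\<Sum>e\<in>\<Omega>. (\<bar>c e\<bar> * L - - (\<bar>c e\<bar> * L))\<^sup>2) = 4 * L\<^sup>2 * S"
    by (simp add: S_def power_mult_distrib sum_distrib_left mult_ac)
  have "measure_pmf.prob ?P {Y. \<epsilon> \<le> (\<Sum>e\<in>\<Omega>. ?X e Y)} \<le> exp (- 2 * \<epsilon>\<^sup>2 / (4 * L\<^sup>2 * S))"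
    using Hoeffding_ineq_ge[of \<epsilon>] eps S L unfolding mu width by simp
  also have "\<dots> \<le> exp (- \<epsilon>\<^sup>2 / (2 * B * L\<^sup>2))"
  proof -
    have "\<epsilon>\<^sup>2 / (2 * B * L\<^sup>2) \<le> \<epsilon>\<^sup>2 / (2 * S * L\<^sup>2)"
      using S L B by (intro divide_left_mono mult_mono) auto
    then show ?thesis by (simp add: mult_ac)
  qed
  finally show ?thesis .
qed

lemma sum_if_mem_edges:
  fixes h :: "nat \<times> nat \<Rightarrow> 'a :: comm_monoid_add"
  assumes "\<Omega> \<subseteq> {..<m} \<times> {..<n}"
  shows "(\<Sum>i<m. \<Sum>j<n. if (i, j) \<in> \<Omega> then h (i, j) else 0) = (\<Sum>e\<in>\<Omega>. h e)"
proof -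
  have "(\<Sum>i<m. \<Sum>j<n. if (i, j) \<in> \<Omega> then h (i, j) else 0) =
      (\<Sum>e\<in>{..<m} \<times> {..<n}. if e \<in> \<Omega> then h e else 0)"
    unfolding sum.cartesian_product by (intro sum.cong) auto
  also have "\<dots> = (\<Sum>e\<in>\<Omega>. h e)"
    using assms by (subst sum.inter_restrict[symmetric]) (auto simp: Int_absorb1)
  finally show ?thesis .
qed

lemma prob_op_bound_Pi_pmf:
  fixes g :: "nat \<times> nat \<Rightarrow> 'y \<Rightarrow> real"
  assumes \<Omega>: "\<Omega> \<subseteq> {..<m} \<times> {..<n}" and n: "0 < n" "n \<le> m" and L: "0 < L"
    and mean: "\<And>e. e \<in> \<Omega> \<Longrightarrow> measure_pmf.expectation (D e) (g e) = 0"
    and bound: "\<And>e y. e \<in> \<Omega> \<Longrightarrow> y \<in> set_pmf (D e) \<Longrightarrow> \<bar>g e y\<bar> \<le> L"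
  shows "measure_pmf.prob (Pi_pmf \<Omega> dflt D)
    {Y. op_bound m n (\<lambda>i j. if (i, j) \<in> \<Omega> then g (i, j) (Y (i, j)) else 0) (24 * L * sqrt (real m))}
    \<ge> 1 - exp (- real m)"
proof -
  have m: "0 < m" using n by simp
  have fin: "finite \<Omega>" using \<Omega> finite_subset by blast
  let ?P = "Pi_pmf \<Omega> dflt D"
  \<comment> \<open>The factor 6 makes the tail exponent 18 m exceed 12 m, which bounds the
    logarithm of the number of pairs of net points. The two nets then turn M into 4 M = 24 L sqrt
    m.\<close>
  define M where "M = 6 * L * sqrt (real m)"
  define \<epsilon> where "\<epsilon> = 4 * sqrt (real m) * sqrt (real n) * M"
  have eps: "0 < \<epsilon>" using m n L by (simp add: \<epsilon>_def M_def)
  define W where "W Y k l = (\<Sum>e\<in>\<Omega>. real_of_int (k (fst e) * l (snd e)) * g e (Y e))"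
    for Y and k l :: "nat \<Rightarrow> int"
  define bad where "bad k l = {Y. \<epsilon> \<le> W Y k l}" for k l
  let ?I = "lattice_ball m \<times> lattice_ball n"
  let ?good = "{Y. op_bound m n (\<lambda>i j. if (i, j) \<in> \<Omega> then g (i, j) (Y (i, j)) else 0) (24 * L * sqrt (real m))}"
  have W_eq: "(\<Sum>i<m. \<Sum>j<n. real_of_int (k i) * real_of_int (l j) *
      (if (i, j) \<in> \<Omega> then g (i, j) (Y (i, j)) else 0)) = W Y k l" for Y k l
  proof -
    have "(\<Sum>i<m. \<Sum>j<n. real_of_int (k i) * real_of_int (l j) *
        (if (i, j) \<in> \<Omega> then g (i, j) (Y (i, j)) else 0)) =
      (\<Sum>i<m. \<Sum>j<n. if (i, j) \<in> \<Omega>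
        then real_of_int (k (fst (i, j)) * l (snd (i, j))) * g (i, j) (Y (i, j)) else 0)"
      by (intro sum.cong) auto
    also have "\<dots> = W Y k l" unfolding W_def by (rule sum_if_mem_edges[OF \<Omega>])
    finally show ?thesis .
  qed
  have "- ?good \<subseteq> (\<Union>(k, l)\<in>?I. bad k l)"
  proof (rule subsetI, rule ccontr)
    fix Y assume Y: "Y \<in> - ?good" and not_bad: "Y \<notin> (\<Union>(k, l)\<in>?I. bad k l)"
    have "W Y k l \<le> \<epsilon>" if "k \<in> lattice_ball m" "l \<in> lattice_ball n" for k l
    proof -
      have "Y \<notin> bad k l" using not_bad that by blast
      then show ?thesis by (simp add: bad_def)
    qed
    then have "op_bound m n (\<lambda>i j. if (i, j) \<in> \<Omega> then g (i, j) (Y (i, j)) else 0) (4 * M)"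
      by (intro op_bound_if_lattice_ball m n) (simp add: W_eq \<epsilon>_def)
    then show False using Y by (simp add: M_def mult_ac)
  qed
  then have "measure_pmf.prob ?P (- ?good) \<le> measure_pmf.prob ?P (\<Union>(k, l)\<in>?I. bad k l)"
    by (intro measure_pmf.finite_measure_mono) auto
  also have "\<dots> \<le> (\<Sum>kl\<in>?I. measure_pmf.prob ?P (case kl of (k, l) \<Rightarrow> bad k l))"
    by (intro measure_pmf.finite_measure_subadditive_finite) (auto simp: card_lattice_ball)
  \<comment> \<open>The weights k_i l_j have square sum at most 4 m times 4 n, and the threshold is
    24 L m sqrt n, so the exponent is 576 L^2 m^2 n / (32 m n L^2) = 18 m.\<close>
  also have "\<dots> \<le> (\<Sum>kl\<in>?I. exp (- 18 * real m))"
  proof (intro sum_mono)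
    fix kl assume "kl \<in> ?I"
    then obtain k l where kl: "kl = (k, l)" and k: "k \<in> lattice_ball m" and l: "l \<in> lattice_ball n"
      by auto
    have "(\<Sum>e\<in>\<Omega>. (real_of_int (k (fst e) * l (snd e)))\<^sup>2)
      \<le> (\<Sum>e\<in>{..<m} \<times> {..<n}. (real_of_int (k (fst e) * l (snd e)))\<^sup>2)"
      using \<Omega> by (intro sum_mono2) auto
    also have "\<dots> = real_of_int ((\<Sum>i<m. (k i)\<^sup>2) * (\<Sum>j<n. (l j)\<^sup>2))"
      by (simp add: sum_product sum.cartesian_product case_prod_beta power_mult_distrib)
    also have "\<dots> \<le> real_of_int ((4 * int m) * (4 * int n))"
      unfolding of_int_le_iff
      using k l by (intro mult_mono) (auto simp: lattice_ball_def sum_nonneg)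
    finally have c: "(\<Sum>e\<in>\<Omega>. (real_of_int (k (fst e) * l (snd e)))\<^sup>2) \<le> 16 * real m * real n"
      by simp
    have "measure_pmf.prob ?P (bad k l) \<le> exp (- \<epsilon>\<^sup>2 / (2 * (16 * real m * real n) * L\<^sup>2))"
      unfolding bad_def W_def
      by (rule prob_weighted_sum_Pi_pmf_ge[OF fin L _ eps mean bound c]) (use m n in auto)
    also have "- \<epsilon>\<^sup>2 / (2 * (16 * real m * real n) * L\<^sup>2) = - 18 * real m"
      using m n L by (simp add: \<epsilon>_def M_def power_mult_distrib field_simps)
    finally show "measure_pmf.prob ?P (case kl of (k, l) \<Rightarrow> bad k l) \<le> exp (- 18 * real m)"
      by (simp add: kl)
  qed
  also have "\<dots> = real (card (lattice_ball m)) * real (card (lattice_ball n)) * exp (- 18 * real m)"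
    by (simp add: card_cartesian_product)
  also have "\<dots> \<le> 48 ^ m * 48 ^ m * exp (- 18 * real m)"
    using order_trans[OF card_lattice_ball(2)[of n] power_increasing[OF n(2), of 48]]
    by (intro mult_right_mono mult_mono card_lattice_ball) auto
  also have "\<dots> \<le> exp (12 * real m) * exp (- 18 * real m)"
  proof -
    \<comment> \<open>The chain 48 <= 64 = 2^6 <= e^6 brings the size of the net to the exponential
      scale.\<close>
    have "(2::real) ^ 6 \<le> exp 1 ^ 6"
      using exp_ge_add_one_self[of 1] by (intro power_mono) auto
    then have "(48::real) \<le> exp 6" by (simp flip: exp_of_nat_mult)
    then have "(48::real) ^ m \<le> exp 6 ^ m" by (intro power_mono) auto
    then have "(48::real) ^ m \<le> exp (6 * real m)" by (simp add: mult.commute flip: exp_of_nat_mult)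
    then have "(48::real) ^ m * 48 ^ m \<le> exp (6 * real m) * exp (6 * real m)" by (intro mult_mono) auto
    then show ?thesis by (intro mult_right_mono) (auto simp flip: exp_add)
  qed
  also have "\<dots> \<le> exp (- real m)" by (simp flip: exp_add)
  finally have "measure_pmf.prob ?P (- ?good) \<le> exp (- real m)" .
  moreover have "measure_pmf.prob ?P (- ?good) = 1 - measure_pmf.prob ?P ?good"
    using measure_pmf.prob_compl[of ?good ?P] by (simp add: Compl_eq_Diff_UNIV)
  ultimately show ?thesis by simp
qed

section \<open>Strong convexity of the likelihood\<close>

lemma strongly_convex_above_tangent:
  fixes g g' g'' :: "real \<Rightarrow> real"
  assumes "\<And>x. x \<in> {a..b} \<Longrightarrow> DERIV g x :> g' x" "\<And>x. x \<in> {a..b} \<Longrightarrow> DERIV g' x :> g'' x"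
    and \<gamma>: "\<And>x. x \<in> {a..b} \<Longrightarrow> \<gamma> \<le> g'' x"
    and c: "c \<in> {a..b}" and x: "x \<in> {a..b}"
  shows "g c + g' c * (x - c) + \<gamma> / 2 * (x - c)\<^sup>2 \<le> g x"
proof (cases "x = c")
  case False
  define diff where "diff k = (if k = 0 then g else if k = 1 then g' else g'')" for k :: nat
  have "\<forall>k t. k < 2 \<and> a \<le> t \<and> t \<le> b \<longrightarrow> DERIV (diff k) t :> diff (Suc k) t"
    using assms by (auto simp: diff_def less_Suc_eq numeral_2_eq_2)
  then obtain t where t: "if x < c then x < t \<and> t < c else c < t \<and> t < x"
    and g: "g x = (\<Sum>k<2. diff k c / fact k * (x - c) ^ k) + diff 2 t / fact 2 * (x - c)\<^sup>2"
    using Taylor[of 2 diff g a b c x] c x False by (auto simp: diff_def)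
  have "t \<in> {a..b}" using t c x by (auto split: if_splits)
  then have "\<gamma> * (x - c)\<^sup>2 \<le> g'' t * (x - c)\<^sup>2" by (intro mult_right_mono \<gamma>) auto
  then show ?thesis using g by (simp add: diff_def numeral_2_eq_2)
qed simp

text \<open>The two second derivatives are the expressions whose infima form
  \<open>gamma_bound\<close>, so gamma is a modulus of strong convexity for either sign of the
  observation.\<close>

lemma
  assumes f: "twice_differentiable f" and pos: "0 < f x" "f x < 1"
  shows DERIV_neg_ln_link: "DERIV (\<lambda>x. - ln (f x)) x :> - (deriv f x / f x)"
    and DERIV_neg_ln_link': "DERIV (\<lambda>x. - (deriv f x / f x)) x :>
      (deriv f x)\<^sup>2 / (f x)\<^sup>2 - deriv (deriv f) x / f x"
    and DERIV_neg_ln_colink: "DERIV (\<lambda>x. - ln (1 - f x)) x :> deriv f x / (1 - f x)"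
    and DERIV_neg_ln_colink': "DERIV (\<lambda>x. deriv f x / (1 - f x)) x :>
      (deriv f x)\<^sup>2 / (1 - f x)\<^sup>2 + deriv (deriv f) x / (1 - f x)"
proof -
  have f1: "DERIV f x :> deriv f x" and f2: "DERIV (deriv f) x :> deriv (deriv f) x"
    using f by (auto simp: twice_differentiable_def DERIV_deriv_iff_real_differentiable)
  show "DERIV (\<lambda>x. - ln (f x)) x :> - (deriv f x / f x)"
    using pos by (auto intro!: derivative_eq_intros f1)
  show "DERIV (\<lambda>x. - (deriv f x / f x)) x :>
      (deriv f x)\<^sup>2 / (f x)\<^sup>2 - deriv (deriv f) x / f x"
    using pos by (auto intro!: derivative_eq_intros f1 f2 simp: field_simps power2_eq_square)
  show "DERIV (\<lambda>x. - ln (1 - f x)) x :> deriv f x / (1 - f x)"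
    using pos by (auto intro!: derivative_eq_intros f1)
  show "DERIV (\<lambda>x. deriv f x / (1 - f x)) x :>
      (deriv f x)\<^sup>2 / (1 - f x)\<^sup>2 + deriv (deriv f) x / (1 - f x)"
  proof (rule DERIV_cong[OF DERIV_divide[OF f2 DERIV_diff[OF DERIV_const f1]]])
    define q where "q = 1 - f x"
    have q: "q \<noteq> 0" using pos by (simp add: q_def)
    then show "1 - f x \<noteq> 0" by (simp add: q_def)
    show "(deriv (deriv f) x * (1 - f x) - deriv f x * (0 - deriv f x)) / ((1 - f x) * (1 - f x)) =
      (deriv f x)\<^sup>2 / (1 - f x)\<^sup>2 + deriv (deriv f) x / (1 - f x)"
      unfolding q_def[symmetric] using q by (simp add: field_simps power2_eq_square)
  qed
qed

definition nll_term :: "(real \<Rightarrow> real) \<Rightarrow> int \<Rightarrow> real \<Rightarrow> real" where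
  "nll_term f y x = - (of_bool (y = 1) * ln (f x) + of_bool (y = - 1) * ln (1 - f x))"

text \<open>The derivative of \<open>nll_term f y\<close> at \<open>x\<close> for y = 1 and y = -1.
  It has mean zero under the model, as the weights f and 1 - f cancel the denominators. Other values
  of \<open>y\<close> are treated like -1, so the bound by L holds for every
  \<open>y\<close>.\<close>

definition nll_score :: "(real \<Rightarrow> real) \<Rightarrow> real \<Rightarrow> int \<Rightarrow> real" where
  "nll_score f x y = (if y = 1 then - (deriv f x / f x) else deriv f x / (1 - f x))"

lemma nll_term_above_tangent:
  assumes f: "twice_differentiable f" and pos: "\<And>x. \<bar>x\<bar> \<le> \<alpha> \<Longrightarrow> 0 < f x \<and> f x < 1"
    and \<gamma>: "ereal \<gamma> \<le> gamma_bound f \<alpha>" and y: "y \<in> {1, - 1}"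
    and c: "\<bar>c\<bar> \<le> \<alpha>" and x: "\<bar>x\<bar> \<le> \<alpha>"
  shows "nll_term f y c + nll_score f c y * (x - c) + \<gamma> / 2 * (x - c)\<^sup>2 \<le> nll_term f y x"
proof -
  have pos': "0 < f x" "f x < 1" if "x \<in> {- \<alpha>..\<alpha>}" for x using pos[of x] that by auto
  have g1: "\<gamma> \<le> (deriv f x)\<^sup>2 / (f x)\<^sup>2 - deriv (deriv f) x / f x"
    and g2: "\<gamma> \<le> (deriv f x)\<^sup>2 / (1 - f x)\<^sup>2 + deriv (deriv f) x / (1 - f x)"
    if "x \<in> {- \<alpha>..\<alpha>}" for x
    using \<gamma> that unfolding gamma_bound_def min.bounded_iff le_INF_iff by (auto simp del: ereal_less_eq simp: ereal_less_eq(3)[symmetric])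
  have cx: "c \<in> {- \<alpha>..\<alpha>}" "x \<in> {- \<alpha>..\<alpha>}" using c x by auto
  show ?thesis
  proof (cases "y = 1")
    case True
    have "- ln (f c) + - (deriv f c / f c) * (x - c) + \<gamma> / 2 * (x - c)\<^sup>2 \<le> - ln (f x)"
      by (rule strongly_convex_above_tangent[OF DERIV_neg_ln_link[OF f pos']
            DERIV_neg_ln_link'[OF f pos'] g1 cx])
    then show ?thesis using True by (simp add: nll_term_def nll_score_def)
  next
    case False
    have "- ln (1 - f c) + deriv f c / (1 - f c) * (x - c) + \<gamma> / 2 * (x - c)\<^sup>2 \<le> - ln (1 - f x)"
      by (rule strongly_convex_above_tangent[OF DERIV_neg_ln_colink[OF f pos']
            DERIV_neg_ln_colink'[OF f pos'] g2 cx])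
    then show ?thesis using False y by (simp add: nll_term_def nll_score_def)
  qed
qed

lemma abs_nll_score_le:
  assumes "0 < f x" "f x < 1" and L: "L_bound f \<alpha> \<le> ereal L" and x: "\<bar>x\<bar> \<le> \<alpha>"
  shows "\<bar>nll_score f x y\<bar> \<le> L"
proof -
  have "\<bar>deriv f x\<bar> / (f x * (1 - f x)) \<le> L"
  proof -
    have "x \<in> {- \<alpha>..\<alpha>}" using x by auto
    then have "ereal (\<bar>deriv f x\<bar> / (f x * (1 - f x))) \<le> ereal L"
      using L unfolding L_bound_def SUP_le_iff by blast
    then show ?thesis by simp
  qed
  moreover have "\<bar>deriv f x\<bar> / f x \<le> \<bar>deriv f x\<bar> / (f x * (1 - f x))"
    using assms(1,2) by (intro divide_left_mono) (auto simp: mult_le_cancel_left1)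
  moreover have "\<bar>deriv f x\<bar> / (1 - f x) \<le> \<bar>deriv f x\<bar> / (f x * (1 - f x))"
    using assms(1,2) by (intro divide_left_mono) (auto simp: mult_le_cancel_right1)
  ultimately show ?thesis using assms(1,2) by (auto simp: nll_score_def abs_divide)
qed

lemma expectation_nll_score:
  assumes "0 < f x" "f x < 1"
  shows "measure_pmf.expectation (map_pmf (\<lambda>b. if b then 1 else - 1) (bernoulli_pmf (f x)))
    (nll_score f x) = 0"
  using assms by (simp add: nll_score_def)

section \<open>The spectral gap and the deterministic error bound\<close>

lemma op_bound_biadjacency_minus_density:
  assumes \<Omega>: "\<Omega> \<subseteq> {..<m} \<times> {..<n}" and m: "0 < m" and n: "0 < n"
    and reg: "\<And>i. i < m \<Longrightarrow> card {j. (i, j) \<in> \<Omega>} = d"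
    and A1: "assumption_A1 m n \<Omega>" and s: "sing_val 2 (biadjacency m n \<Omega>) \<le> s" "0 \<le> s"
  shows "op_bound m n (\<lambda>i j. of_bool ((i, j) \<in> \<Omega>) - real d / real n) s"
  unfolding op_bound_def
proof
  fix y :: "nat \<Rightarrow> real"
  let ?G = "biadjacency m n \<Omega>"
  have G: "?G \<in> carrier_mat m n" by (simp add: biadjacency_def)
  \<comment> \<open>With row sums d, applying G - (d/n) J to y is the same as applying G to y minus
    its mean \<open>a\<close>. Centring also does not increase the norm.\<close>
  define a where "a = (\<Sum>j<n. y j) / n"
  have a: "(\<Sum>j<n. y j) = n * a" using n by (simp add: a_def)
  have "(\<Sum>j<n. y j - a) = 0" by (simp add: sum_subtractf a)
  from L2_set_mult_le_sing_val_2[OF G m n A1[unfolded assumption_A1_def] this]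
  have gap: "L2_set (\<lambda>i. \<Sum>j<n. ?G $$ (i, j) * (y j - a)) {..<m} \<le> sing_val 2 ?G * L2_set (\<lambda>j. y j - a) {..<n}" .
  have "(\<Sum>j<n. (of_bool ((i, j) \<in> \<Omega>) - real d / real n) * y j) = (\<Sum>j<n. ?G $$ (i, j) * (y j - a))"
    if i: "i < m" for i
  proof -
    have "{j. (i, j) \<in> \<Omega>} = {..<n} \<inter> {j. (i, j) \<in> \<Omega>}" using \<Omega> by auto
    then have "(\<Sum>j<n. of_bool ((i, j) \<in> \<Omega>)) = real d" using reg[OF i] by simp
    then have row: "(\<Sum>j<n. of_bool ((i, j) \<in> \<Omega>) * a) = d * a" by (simp flip: sum_distrib_right)
    have "(\<Sum>j<n. real d / real n * y j) = d * a" by (simp add: a_def sum_distrib_left sum_divide_distrib)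
    then have "(\<Sum>j<n. (of_bool ((i, j) \<in> \<Omega>) - real d / real n) * y j) =
        (\<Sum>j<n. of_bool ((i, j) \<in> \<Omega>) * (y j - a))"
      unfolding left_diff_distrib right_diff_distrib sum_subtractf row by simp
    also have "\<dots> = (\<Sum>j<n. ?G $$ (i, j) * (y j - a))"
      using i by (intro sum.cong) (auto simp: biadjacency_def)
    finally show ?thesis .
  qed
  then have "L2_set (\<lambda>i. \<Sum>j<n. (of_bool ((i, j) \<in> \<Omega>) - real d / real n) * y j) {..<m} =
      L2_set (\<lambda>i. \<Sum>j<n. ?G $$ (i, j) * (y j - a)) {..<m}"
    by (intro L2_set_cong) auto
  also note gap
  finally have le: "L2_set (\<lambda>i. \<Sum>j<n. (of_bool ((i, j) \<in> \<Omega>) - real d / real n) * y j) {..<m}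
      \<le> sing_val 2 ?G * L2_set (\<lambda>j. y j - a) {..<n}" .
  have "(\<Sum>j<n. (y j - a)\<^sup>2) = (\<Sum>j<n. (y j)\<^sup>2) + n * a\<^sup>2 - 2 * a * (\<Sum>j<n. y j)"
    by (simp add: power2_diff sum.distrib sum_subtractf sum_distrib_left mult_ac)
  also have "\<dots> \<le> (\<Sum>j<n. (y j)\<^sup>2)" unfolding a
    using mult_nonneg_nonneg[of "real n" "a\<^sup>2"] by (simp add: power2_eq_square algebra_simps)
  finally have centred: "L2_set (\<lambda>j. y j - a) {..<n} \<le> L2_set y {..<n}" by (simp add: L2_set_def)
  note le
  also have "sing_val 2 ?G * L2_set (\<lambda>j. y j - a) {..<n} \<le> s * L2_set y {..<n}"
    using s centred by (intro mult_mono) (auto simp: L2_set_nonneg)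
  finally show "L2_set (\<lambda>i. \<Sum>j<n. (of_bool ((i, j) \<in> \<Omega>) - real d / real n) * y j) {..<m}
      \<le> s * L2_set y {..<n}" .
qed

lemma sum_square_edges_ge:
  assumes \<Omega>: "\<Omega> \<subseteq> {..<m} \<times> {..<n}"
    and gap: "op_bound m n (\<lambda>i j. of_bool ((i, j) \<in> \<Omega>) - p) s" "0 \<le> s"
    and D: "rank_le m n k D" and \<beta>: "\<And>i j. i < m \<Longrightarrow> j < n \<Longrightarrow> \<bar>D i j\<bar> \<le> \<beta>" "0 \<le> \<beta>"
  shows "p * (frob m n D)\<^sup>2 - s * real k * \<beta> * frob m n D \<le> (\<Sum>(i, j)\<in>\<Omega>. (D i j)\<^sup>2)"
proof -
  let ?S = "\<lambda>i j. (D i j)\<^sup>2"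
  have "(frob m n ?S)\<^sup>2 = (\<Sum>i<m. \<Sum>j<n. (D i j)\<^sup>2 * (D i j)\<^sup>2)"
    by (simp add: frob_def sum_nonneg power2_eq_square)
  also have "\<dots> \<le> (\<Sum>i<m. \<Sum>j<n. \<beta>\<^sup>2 * (D i j)\<^sup>2)"
  proof (intro sum_mono mult_right_mono)
    fix i j assume "i \<in> {..<m}" "j \<in> {..<n}"
    then show "(D i j)\<^sup>2 \<le> \<beta>\<^sup>2" using \<beta> power_mono[of "\<bar>D i j\<bar>" \<beta> 2] by simp
  qed auto
  also have "\<dots> = (\<beta> * frob m n D)\<^sup>2"
    by (simp add: frob_def power_mult_distrib sum_nonneg sum_distrib_left)
  finally have frob_le: "frob m n ?S \<le> \<beta> * frob m n D"
    by (rule power2_le_imp_le) (simp add: \<beta> frob_nonneg)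
  \<comment> \<open>The sum over the edges is linear in the entrywise square of \<open>D\<close>, so
    its deviation from p |D|_F^2 is a pairing with G - p J.\<close>
  have "(\<Sum>i<m. \<Sum>j<n. (of_bool ((i, j) \<in> \<Omega>) - p) * ?S i j) =
      (\<Sum>i<m. \<Sum>j<n. if (i, j) \<in> \<Omega> then (case (i, j) of (i, j) \<Rightarrow> ?S i j) else 0) - p * (\<Sum>i<m. \<Sum>j<n. ?S i j)"
    unfolding left_diff_distrib sum_subtractf sum_distrib_left
    by (intro arg_cong2[where f = "(-)"] sum.cong) auto
  also have "\<dots> = (\<Sum>(i, j)\<in>\<Omega>. (D i j)\<^sup>2) - p * (frob m n D)\<^sup>2"
    unfolding sum_if_mem_edges[OF \<Omega>] by (simp add: frob_def sum_nonneg)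
  finally have "p * (frob m n D)\<^sup>2 - (\<Sum>(i, j)\<in>\<Omega>. (D i j)\<^sup>2) \<le> s * sqrt (real (k * k)) * frob m n ?S"
    using abs_inner_le_op_bound_frob[OF gap rank_le_square[OF D]] by linarith
  also have "\<dots> \<le> s * real k * (\<beta> * frob m n D)"
    using gap(2) frob_le by (simp add: mult_left_mono)
  finally show ?thesis by (simp add: mult_ac)
qed

lemma abs_entry_le_constraint_set:
  assumes "M \<in> constraint_set m n \<alpha> r" "i < m" "j < n"
  shows "\<bar>M $$ (i, j)\<bar> \<le> \<alpha>"
proof -
  have "M $$ (i, j) \<in> elements_mat M"
    using assms by (intro elements_matI) (auto simp: constraint_set_def)
  moreover have "finite (elements_mat M)" by (simp add: elements_mat_def)
  ultimately have "\<bar>M $$ (i, j)\<bar> \<le> max_norm M" unfolding max_norm_def by (intro Max_ge) auto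
  then show ?thesis using assms by (simp add: constraint_set_def)
qed

text \<open>The part without probability: \<open>Y\<close> is one sample of signs whose score matrix
  satisfies \<open>noise\<close>. Both estimates of the edge sum are of order N = |D|_F, apart from
  p N^2, so one factor N can be divided out.\<close>

lemma error_bound_if_op_bound_score:
  fixes m n r :: nat and Y :: "nat \<times> nat \<Rightarrow> int"
  assumes n: "0 < n" "n \<le> m" and \<Omega>: "\<Omega> \<subseteq> {..<m} \<times> {..<n}"
    and f: "twice_differentiable f" and pos: "\<And>x. \<bar>x\<bar> \<le> \<alpha> \<Longrightarrow> 0 < f x \<and> f x < 1"
    and \<gamma>: "0 < \<gamma>" "ereal \<gamma> \<le> gamma_bound f \<alpha>" and \<alpha>: "0 < \<alpha>"
    and Ms: "Ms \<in> constraint_set m n \<alpha> r" and Mh: "Mh \<in> constraint_set m n \<alpha> r"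
    and opt: "neg_log_lik f \<Omega> Y Mh \<le> neg_log_lik f \<Omega> Y Ms"
    and gap: "op_bound m n (\<lambda>i j. of_bool ((i, j) \<in> \<Omega>) - p) s" "0 \<le> s" and p: "0 < p"
    and Y: "\<And>e. e \<in> \<Omega> \<Longrightarrow> Y e \<in> {1, - 1}"
    and noise: "op_bound m n (\<lambda>i j. if (i, j) \<in> \<Omega> then nll_score f (Ms $$ (i, j)) (Y (i, j)) else 0) S"
      "0 \<le> S"
  shows "p * frobenius_norm (Mh - Ms) \<le> real r * (4 * S / \<gamma> + 4 * \<alpha> * s)"
proof -
  define D where "D i j = Mh $$ (i, j) - Ms $$ (i, j)" for i j
  have rank: "rank_le m n r (\<lambda>i j. M $$ (i, j))" if "M \<in> constraint_set m n \<alpha> r" for M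
    using that by (intro rank_le_if_mat_rank_le) (auto simp: constraint_set_def)
  have D: "rank_le m n (r + r) D" unfolding D_def by (intro rank_le_diff rank Ms Mh)
  define N where "N = frob m n D"
  have N0: "0 \<le> N" by (simp add: N_def frob_nonneg)
  have frob_N: "frobenius_norm (Mh - Ms) = N"
    using Ms Mh by (auto simp: frobenius_norm_def N_def frob_def D_def constraint_set_def)
  have D_le: "\<bar>D i j\<bar> \<le> 2 * \<alpha>" if "i < m" "j < n" for i j
    using abs_entry_le_constraint_set[OF Ms that] abs_entry_le_constraint_set[OF Mh that] by (auto simp: D_def)
  define score where "score e = nll_score f (Ms $$ e) (Y e)" for e
  have term_le: "nll_term f (Y (i, j)) (Ms $$ (i, j)) + score (i, j) * D i j + \<gamma> / 2 * (D i j)\<^sup>2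
      \<le> nll_term f (Y (i, j)) (Mh $$ (i, j))" if "(i, j) \<in> \<Omega>" for i j
    unfolding score_def D_def using that \<Omega>
    by (intro nll_term_above_tangent[OF f pos \<gamma>(2) Y] abs_entry_le_constraint_set[OF Ms] abs_entry_le_constraint_set[OF Mh]) auto
  have nll: "neg_log_lik f \<Omega> Y M = (\<Sum>(i, j)\<in>\<Omega>. nll_term f (Y (i, j)) (M $$ (i, j)))" for M
    by (simp add: neg_log_lik_def nll_term_def case_prod_beta sum.distrib sum_subtractf sum_negf)
  have "(\<Sum>(i, j)\<in>\<Omega>. nll_term f (Y (i, j)) (Ms $$ (i, j)) + score (i, j) * D i j + \<gamma> / 2 * (D i j)\<^sup>2)
      \<le> (\<Sum>(i, j)\<in>\<Omega>. nll_term f (Y (i, j)) (Mh $$ (i, j)))"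
    by (intro sum_mono) (use term_le in auto)
  also have "\<dots> \<le> (\<Sum>(i, j)\<in>\<Omega>. nll_term f (Y (i, j)) (Ms $$ (i, j)))"
    using opt by (simp only: nll)
  finally have basic: "\<gamma> / 2 * (\<Sum>(i, j)\<in>\<Omega>. (D i j)\<^sup>2) \<le> - (\<Sum>(i, j)\<in>\<Omega>. score (i, j) * D i j)"
    by (simp add: case_prod_beta sum.distrib sum_distrib_left)
  have "(\<Sum>(i, j)\<in>\<Omega>. score (i, j) * D i j) =
      (\<Sum>i<m. \<Sum>j<n. if (i, j) \<in> \<Omega> then (case (i, j) of (i, j) \<Rightarrow> score (i, j) * D i j) else 0)"
    by (rule sum_if_mem_edges[OF \<Omega>, symmetric])
  also have "\<dots> = (\<Sum>i<m. \<Sum>j<n. (if (i, j) \<in> \<Omega> then nll_score f (Ms $$ (i, j)) (Y (i, j)) else 0) * D i j)"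
    by (intro sum.cong) (auto simp: score_def)
  finally have "- (\<Sum>(i, j)\<in>\<Omega>. score (i, j) * D i j) \<le> S * sqrt (real (r + r)) * N"
    using abs_inner_le_op_bound_frob[OF noise D] unfolding N_def by linarith
  \<comment> \<open>Weakening sqrt (2 r) to 2 r gives this term the same dependence on r as the
    spectral gap term, where the rank of the squared matrix already costs a factor 2 r.\<close>
  also have "\<dots> \<le> S * (2 * real r) * N"
  proof (intro mult_right_mono mult_left_mono)
    have "real (r + r) \<le> (2 * real r)\<^sup>2"
      using self_le_power[of "2 * real r" 2] by (cases "r = 0") auto
    then show "sqrt (real (r + r)) \<le> 2 * real r" by (intro real_le_lsqrt) auto
  qed (use N0 noise in auto)
  finally have upper: "(\<Sum>(i, j)\<in>\<Omega>. (D i j)\<^sup>2) \<le> 4 * S / \<gamma> * real r * N"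
    using basic \<gamma>(1) by (simp add: field_simps)
  have "p * N\<^sup>2 - s * real (r + r) * (2 * \<alpha>) * N \<le> (\<Sum>(i, j)\<in>\<Omega>. (D i j)\<^sup>2)"
    unfolding N_def using \<alpha> by (intro sum_square_edges_ge[OF \<Omega> gap D D_le]) auto
  then have "p * N\<^sup>2 - s * real (r + r) * (2 * \<alpha>) * N \<le> 4 * S / \<gamma> * real r * N"
    using upper by linarith
  then have "(p * N) * N \<le> (real r * (4 * S / \<gamma> + 4 * \<alpha> * s)) * N"
    by (simp add: power2_eq_square algebra_simps)
  moreover have "0 \<le> real r * (4 * S / \<gamma> + 4 * \<alpha> * s)" using noise(2) gap(2) \<alpha> \<gamma>(1) by simp
  ultimately have "p * N \<le> real r * (4 * S / \<gamma> + 4 * \<alpha> * s)"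
    using N0 by (cases "N = 0") auto
  then show ?thesis by (simp add: frob_N)
qed


lemma prob_op_bound_score:
  assumes n: "0 < n" "n \<le> m" and \<Omega>: "\<Omega> \<subseteq> {..<m} \<times> {..<n}"
    and M: "\<And>e. e \<in> \<Omega> \<Longrightarrow> \<bar>M $$ e\<bar> \<le> \<alpha>"
    and pos: "\<And>x. \<bar>x\<bar> \<le> \<alpha> \<Longrightarrow> 0 < f x \<and> f x < 1"
    and L: "L_bound f \<alpha> \<le> ereal L" "0 < L"
  shows "measure_pmf.prob (one_bit_model f M \<Omega>)
    {Y. op_bound m n (\<lambda>i j. if (i, j) \<in> \<Omega> then nll_score f (M $$ (i, j)) (Y (i, j)) else 0)
      (24 * L * sqrt (real m))} \<ge> 1 - exp (- real m)"
  unfolding one_bit_model_def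
proof (rule prob_op_bound_Pi_pmf[OF \<Omega> n L(2), where g = "\<lambda>e. nll_score f (M $$ e)"])
  fix e assume e: "e \<in> \<Omega>"
  then show "measure_pmf.expectation (map_pmf (\<lambda>b. if b then 1 else - 1) (bernoulli_pmf (f (M $$ e))))
      (nll_score f (M $$ e)) = 0"
    using pos[OF M[OF e]] by (intro expectation_nll_score) auto
  show "\<bar>nll_score f (M $$ e) y\<bar> \<le> L" for y
    using pos[OF M[OF e]] by (intro abs_nll_score_le[OF _ _ L(1) M[OF e]]) auto
qed

section \<open>The error bound\<close>

theorem mainTheorem2:
  shows "\<exists>C1>0. \<exists>C2>0. \<forall>C>0. \<forall>\<alpha>>0. \<forall>\<gamma>>0. \<forall>L. \<exists>K>0.
    \<forall>(m::nat) (n::nat) (r::nat) (d::nat) (\<delta>::real) (p::real) (f::real \<Rightarrow> real)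
      (\<Omega>::(nat \<times> nat) set) (Mstar::real mat).
      n \<ge> 1 \<longrightarrow> m \<ge> n \<longrightarrow> \<delta> = real m / real n \<longrightarrow> r \<ge> 1 \<longrightarrow>
      range f \<subseteq> {0..1} \<longrightarrow> twice_differentiable f \<longrightarrow> log_concave f \<longrightarrow>
      (\<forall>x. \<bar>x\<bar> \<le> \<alpha> \<longrightarrow> 0 < f x \<and> f x < 1) \<longrightarrow>
      ereal \<gamma> \<le> gamma_bound f \<alpha> \<longrightarrow> L_bound f \<alpha> \<le> ereal L \<longrightarrow>
      Mstar \<in> constraint_set m n \<alpha> r \<longrightarrow>
      \<Omega> \<subseteq> {..<m} \<times> {..<n} \<longrightarrow>
      d \<ge> 1 \<longrightarrow> (\<forall>i<m. card {j. (i, j) \<in> \<Omega>} = d) \<longrightarrow>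
      assumption_A1 m n \<Omega> \<longrightarrow> assumption_A2 m n \<Omega> d C \<longrightarrow>
      p = real (card \<Omega>) / (real m * real n) \<longrightarrow>
      measure_pmf.prob (one_bit_model f Mstar \<Omega>)
        {Y. \<forall>Mhat. is_arg_min (neg_log_lik f \<Omega> Y) (\<lambda>M. M \<in> constraint_set m n \<alpha> r) Mhat \<longrightarrow>
              1 / sqrt (real m * real n) * frobenius_norm (Mhat - Mstar)
                \<le> K * (\<delta> / p\<^sup>2 * sqrt (real r ^ 3 / real n))}
        \<ge> 1 - C1 * exp (- C2 * real m)"
proof (rule exI[of _ "1::real"], rule conjI, simp,
    rule exI[of _ "1::real"], rule conjI, simp, intro allI impI)
  fix C \<alpha> \<gamma> L :: real
  assume C: "C > 0" and \<alpha>: "\<alpha> > 0" and \<gamma>: "\<gamma> > 0"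
  \<comment> \<open>\<open>L\<close> is fixed before its hypothesis is available, so the maximum
    with 1 secures the positivity that the noise bound asks for. In \<open>K\<close>, 96 = 4 times
    24 comes from 4 S / gamma with S = 24 L' sqrt m.\<close>
  define L' where "L' = max L 1"
  define K where "K = 96 * L' / \<gamma> + 4 * \<alpha> * C"
  have L': "L' > 0" "ereal L \<le> ereal L'" by (auto simp: L'_def)
  have K: "K > 0" using L' C \<alpha> \<gamma> by (simp add: K_def add_pos_pos)
  show "\<exists>K>0.
    \<forall>(m::nat) (n::nat) (r::nat) (d::nat) (\<delta>::real) (p::real) (f::real \<Rightarrow> real)
      (\<Omega>::(nat \<times> nat) set) (Mstar::real mat).
      n \<ge> 1 \<longrightarrow> m \<ge> n \<longrightarrow> \<delta> = real m / real n \<longrightarrow> r \<ge> 1 \<longrightarrow>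
      range f \<subseteq> {0..1} \<longrightarrow> twice_differentiable f \<longrightarrow> log_concave f \<longrightarrow>
      (\<forall>x. \<bar>x\<bar> \<le> \<alpha> \<longrightarrow> 0 < f x \<and> f x < 1) \<longrightarrow>
      ereal \<gamma> \<le> gamma_bound f \<alpha> \<longrightarrow> L_bound f \<alpha> \<le> ereal L \<longrightarrow>
      Mstar \<in> constraint_set m n \<alpha> r \<longrightarrow>
      \<Omega> \<subseteq> {..<m} \<times> {..<n} \<longrightarrow>
      d \<ge> 1 \<longrightarrow> (\<forall>i<m. card {j. (i, j) \<in> \<Omega>} = d) \<longrightarrow>
      assumption_A1 m n \<Omega> \<longrightarrow> assumption_A2 m n \<Omega> d C \<longrightarrow>
      p = real (card \<Omega>) / (real m * real n) \<longrightarrow>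
      measure_pmf.prob (one_bit_model f Mstar \<Omega>)
        {Y. \<forall>Mhat. is_arg_min (neg_log_lik f \<Omega> Y) (\<lambda>M. M \<in> constraint_set m n \<alpha> r) Mhat \<longrightarrow>
              1 / sqrt (real m * real n) * frobenius_norm (Mhat - Mstar)
                \<le> K * (\<delta> / p\<^sup>2 * sqrt (real r ^ 3 / real n))}
        \<ge> 1 - 1 * exp (- 1 * real m)"
  proof (intro exI[of _ K] conjI K allI impI)
    fix m n r d :: nat and \<delta> p :: real and f :: "real \<Rightarrow> real"
      and \<Omega> :: "(nat \<times> nat) set" and Ms :: "real mat"
    assume n: "n \<ge> 1" "m \<ge> n" and \<delta>: "\<delta> = real m / real n" and r: "r \<ge> 1"
      and f: "twice_differentiable f" and pos: "\<forall>x. \<bar>x\<bar> \<le> \<alpha> \<longrightarrow> 0 < f x \<and> f x < 1"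
      and gb: "ereal \<gamma> \<le> gamma_bound f \<alpha>" and Lb: "L_bound f \<alpha> \<le> ereal L"
      and Ms: "Ms \<in> constraint_set m n \<alpha> r" and \<Omega>: "\<Omega> \<subseteq> {..<m} \<times> {..<n}"
      and d: "d \<ge> 1" and reg: "\<forall>i<m. card {j. (i, j) \<in> \<Omega>} = d"
      and A1: "assumption_A1 m n \<Omega>" and A2: "assumption_A2 m n \<Omega> d C"
      and p: "p = real (card \<Omega>) / (real m * real n)"
    have m: "m > 0" using n by simp
    have fin: "finite \<Omega>" using \<Omega> finite_subset by blast
    have "\<Omega> = Sigma {..<m} (\<lambda>i. {j. (i, j) \<in> \<Omega>})" using \<Omega> by auto
    moreover have row_sub: "{j. (i, j) \<in> \<Omega>} \<subseteq> {..<n}" for i using \<Omega> by auto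
    then have "finite {j. (i, j) \<in> \<Omega>}" for i by (rule finite_subset) simp
    ultimately have "card \<Omega> = (\<Sum>i<m. card {j. (i, j) \<in> \<Omega>})"
      using card_SigmaI[of "{..<m}" "\<lambda>i. {j. (i, j) \<in> \<Omega>}"] by simp
    then have "card \<Omega> = m * d" using reg by simp
    then have p_eq: "p = real d / real n" using m by (simp add: p)
    have "d \<le> n" using reg m card_mono[OF _ row_sub, of 0] by auto
    then have p01: "0 < p" "p \<le> 1" using d n by (auto simp: p_eq)
    define S where "S = 24 * L' * sqrt m"
    define good where "good = {Y. op_bound m n (\<lambda>i j. if (i, j) \<in> \<Omega>
      then nll_score f (Ms $$ (i, j)) (Y (i, j)) else 0) S}"
    let ?P = "one_bit_model f Ms \<Omega>"
    let ?T = "{Y. \<forall>Mhat. is_arg_min (neg_log_lik f \<Omega> Y) (\<lambda>M. M \<in> constraint_set m n \<alpha> r) Mhat \<longrightarrow>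
              1 / sqrt (real m * real n) * frobenius_norm (Mhat - Ms)
                \<le> K * (\<delta> / p\<^sup>2 * sqrt (real r ^ 3 / real n))}"
    have "1 - exp (- real m) \<le> measure_pmf.prob ?P good"
      unfolding good_def S_def
    proof (rule prob_op_bound_score[where \<alpha> = \<alpha>])
      fix e assume "e \<in> \<Omega>"
      then show "\<bar>Ms $$ e\<bar> \<le> \<alpha>" using \<Omega> by (cases e) (auto intro: abs_entry_le_constraint_set[OF Ms])
    next
      show "L_bound f \<alpha> \<le> ereal L'" using Lb L'(2) by (rule order_trans)
    qed (use n \<Omega> pos L' in auto)
    \<comment> \<open>Restricting to the support guarantees that the values of \<open>Y\<close> on
      the edges are 1 or -1, which the convexity estimate requires.\<close>
    also have "measure_pmf.prob ?P good = measure_pmf.prob ?P (good \<inter> set_pmf ?P)"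
      by (simp add: measure_Int_set_pmf)
    also have "\<dots> \<le> measure_pmf.prob ?P ?T"
    proof (intro measure_pmf.finite_measure_mono subsetI CollectI allI impI)
      fix Y Mh assume Y: "Y \<in> good \<inter> set_pmf ?P"
        and opt: "is_arg_min (neg_log_lik f \<Omega> Y) (\<lambda>M. M \<in> constraint_set m n \<alpha> r) Mh"
      have sign: "Y e \<in> {1, - 1}" if "e \<in> \<Omega>" for e
      proof -
        have "Y e \<in> set_pmf (map_pmf (\<lambda>b. if b then 1 else - 1) (bernoulli_pmf (f (Ms $$ e))))"
          using Y that by (cases e) (simp add: one_bit_model_def set_Pi_pmf[OF fin] PiE_dflt_def)
        then show ?thesis unfolding set_map_pmf by (elim imageE) simp
      qed
      have s: "op_bound m n (\<lambda>i j. of_bool ((i, j) \<in> \<Omega>) - p) (C * sqrt d)"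
        unfolding p_eq
        by (rule op_bound_biadjacency_minus_density) (use \<Omega> m n reg A1 A2 C in \<open>auto simp: assumption_A2_def\<close>)
      have "p * frobenius_norm (Mh - Ms) \<le> real r * (4 * S / \<gamma> + 4 * \<alpha> * (C * sqrt d))"
      proof (rule error_bound_if_op_bound_score[OF _ n(2) \<Omega> f _ \<gamma> gb \<alpha> Ms _ _ s _ p01(1) sign])
        show "Mh \<in> constraint_set m n \<alpha> r" "neg_log_lik f \<Omega> Y Mh \<le> neg_log_lik f \<Omega> Y Ms"
          using opt Ms by (auto simp: is_arg_min_def not_less)
        show "op_bound m n (\<lambda>i j. if (i, j) \<in> \<Omega> then nll_score f (Ms $$ (i, j)) (Y (i, j)) else 0) S"
          using Y by (simp add: good_def)
      qed (use n pos C L' in \<open>auto simp: S_def\<close>)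
      also have "\<dots> \<le> real r * (K * sqrt m)"
      proof (intro mult_left_mono)
        have "sqrt d \<le> sqrt m" using \<open>d \<le> n\<close> n by simp
        then have "4 * \<alpha> * (C * sqrt d) \<le> 4 * \<alpha> * (C * sqrt m)" using \<alpha> C by (intro mult_left_mono) auto
        then show "4 * S / \<gamma> + 4 * \<alpha> * (C * sqrt d) \<le> K * sqrt m"
          by (simp add: K_def S_def algebra_simps)
      qed simp
      finally have main: "frobenius_norm (Mh - Ms) \<le> real r * K * sqrt m / p"
        using p01 by (simp add: pos_le_divide_eq mult_ac)
      \<comment> \<open>From here on the bound K r / (p sqrt n) is only weakened to the stated
        shape.\<close>
      have r_le: "real r \<le> sqrt (real r ^ 3)"
        using r power_increasing[of 2 3 "real r"] by (intro real_le_rsqrt) auto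
      have "1 / p \<le> \<delta> / p\<^sup>2"
      proof -
        have "p \<le> \<delta>" using p01 n by (simp add: \<delta> order_trans[of p 1])
        then show ?thesis using p01 by (simp add: power2_eq_square divide_simps)
      qed
      have "1 / sqrt (real m * real n) * frobenius_norm (Mh - Ms)
        \<le> 1 / sqrt (real m * real n) * (real r * K * sqrt m / p)"
        by (intro mult_left_mono main) simp
      also have "\<dots> = K * (1 / p * (real r / sqrt n))"
        using m by (simp add: real_sqrt_mult mult_ac)
      also have "\<dots> \<le> K * (\<delta> / p\<^sup>2 * (sqrt (real r ^ 3) / sqrt n))"
        using K p01 \<open>1 / p \<le> \<delta> / p\<^sup>2\<close> r_le n
        by (intro mult_left_mono mult_mono divide_right_mono) (auto simp: \<delta>)
      finally show "1 / sqrt (real m * real n) * frobenius_norm (Mh - Ms)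
        \<le> K * (\<delta> / p\<^sup>2 * sqrt (real r ^ 3 / real n))"
        by (simp add: real_sqrt_divide)
    qed simp
    finally show "1 - 1 * exp (- 1 * real m) \<le> measure_pmf.prob ?P ?T" by simp
  qed
qed

end
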